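(* For fixed $a$ and $\lambda \rightarrow \infty$ with $|\arg(\lambda)| \leq \frac{3}{4}\pi - \delta$ \[ L_{U}(a,\lambda) \sim\frac{U(a,0)}{\lambda}\sum_{ s=0}^{\infty} \frac{\alpha_{s}(a)}{\lambda^{2s}}+\frac{U'(a,0)}{\lambda^{2}}\sum_{ s=0}^{\infty} \frac{\beta_{s}(a)}{\lambda^{2s}}, \] where $\alpha_{0}(a)=\beta_{0}(a)=1$, $\alpha_{1}(a)=\beta_{1}(a)=a$, and for $ s=0,1,2,\ldots$ \[ \alpha_{s+2}=a\alpha_{s+1}+\tfrac{1}{2}(s+1)(2s+1)\alpha_{s},\qquad \beta_{s+2}=a\beta_{s+1}+\tfrac{1}{2}(s+1)(2s+3)\beta_{s}, \] \[ U(a,0)=\frac{\sqrt{\pi}}{2^{\frac{1}{2}a+\frac{1}{4}}\Gamma\left(\frac{1}{2}a+\frac{3}{4}\right)},\qquad U'(a,0)=-\frac{\sqrt{\pi}}{2^{\frac{1}{2}a-\frac{1}{4}}\Gamma\left(\frac{1}{2}a+\frac{1}{4}\right)}. \]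
   Context: $U(a,z)$ is the standard parabolic cylinder function, the solution of $y''-(\tfrac14 z^2+a)y=0$ with $U(a,z)\sim z^{-a-1/2}e^{-z^2/4}$ as $z\to\infty$, $|\arg z|\le\tfrac34\pi-\delta$. $L_{U}(a,\lambda)=\int_{0}^{\infty} e^{-\lambda t} U(a,t)dt$ (entire in $\lambda$). $\delta$ denotes an arbitrary small positive constant. *)

theory Defs
  imports "HOL-Analysis.Analysis"
begin

definition pc_sector :: "real \<Rightarrow> complex set" where
  "pc_sector \<delta> = {z. z \<noteq> 0 \<and> \<bar>Arg z\<bar> \<le> 3 * pi / 4 - \<delta>}"

text \<open>U is the standard parabolic cylinder function U(a,.): entire solution of
  y'' - (z^2/4 + a) y = 0 with U(a,z) \<sim> z^(-a-1/2) exp(-z^2/4) as z \<rightarrow> \<infinity>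
  in |arg z| \<le> 3 pi/4 - delta, for every delta > 0.\<close>
definition is_pcfU :: "complex \<Rightarrow> (complex \<Rightarrow> complex) \<Rightarrow> bool" where
  "is_pcfU a U \<longleftrightarrow>
     U holomorphic_on UNIV \<and>
     (\<forall>z. deriv (deriv U) z = (z\<^sup>2 / 4 + a) * U z) \<and>
     (\<forall>\<delta>>0. ((\<lambda>z. U z / (z powr (- a - 1/2) * exp (- z\<^sup>2 / 4))) \<longlongrightarrow> 1)
                (inf at_infinity (principal (pc_sector \<delta>))))"

definition pc_laplace :: "(complex \<Rightarrow> complex) \<Rightarrow> complex \<Rightarrow> complex" where
  "pc_laplace U l = integral {0..} (\<lambda>t::real. exp (- l * of_real t) * U (of_real t))"

fun pc_alpha :: "complex \<Rightarrow> nat \<Rightarrow> complex" where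
  "pc_alpha a 0 = 1"
| "pc_alpha a (Suc 0) = a"
| "pc_alpha a (Suc (Suc s)) =
     a * pc_alpha a (Suc s) + 1/2 * (of_nat s + 1) * (2 * of_nat s + 1) * pc_alpha a s"

fun pc_beta :: "complex \<Rightarrow> nat \<Rightarrow> complex" where
  "pc_beta a 0 = 1"
| "pc_beta a (Suc 0) = a"
| "pc_beta a (Suc (Suc s)) =
     a * pc_beta a (Suc s) + 1/2 * (of_nat s + 1) * (2 * of_nat s + 3) * pc_beta a s"

end

theory Submission
  imports Defs "HOL-Complex_Analysis.Complex_Analysis" "HOL-Real_Asymp.Real_Asymp"
begin

text \<open>
  Values at the origin: \<open>g(z) = exp (- z\<^sup>2 / 4) U(z)\<close> satisfies \<open>g'' + z g' + (1/2 - a) g = 0\<close>, so its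
  moments \<open>M k\<close> (the integrals of \<open>t\<^sup>k g(t)\<close> over \<open>t \<ge> 0\<close>) satisfy
  \<open>(a + k + 1/2) M k = k (k - 1) M (k - 2)\<close> for \<open>k \<ge> 2\<close>, while \<open>(a + 3/2) M 1 = U(0)\<close> and
  \<open>(a + 1/2) M 0 = - U'(0)\<close>. Iterating expresses \<open>U(0)\<close> and \<open>U'(0)\<close> by moments of arbitrarily
  large order, which only depend on the behaviour of \<open>U\<close> at infinity and are asymptotic to explicit
  Gamma integrals; Euler's product for the reciprocal Gamma function then gives the constants. No
  explicit solution of the differential equation is needed.

  Expansion: \<open>U\<close> decays like a Gaussian in every sector strictly inside \<open>\<bar>arg z\<bar> < pi/4\<close>, so the
  integration path can be rotated to a ray in that sector on which \<open>Re (l z) \<ge> c \<bar>l\<bar> \<bar>z\<bar>\<close>; Watson's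
  lemma applies there. The coefficients are the derivatives of \<open>U\<close> at the origin, which satisfy the
  recurrences of \<open>\<alpha>\<close> and \<open>\<beta>\<close> by the differential equation.
\<close>

section \<open>Integrals over the half line\<close>

lemma absolutely_integrable_exp_bound:
  fixes f :: "real \<Rightarrow> 'a::euclidean_space"
  assumes "continuous_on {0..} f" "c > 0"
    and "\<And>t. t \<ge> 0 \<Longrightarrow> norm (f t) \<le> B * exp (- c * t)"
  shows "f absolutely_integrable_on {0..}"
proof (rule measurable_bounded_by_integrable_imp_absolutely_integrable)
  show "f \<in> borel_measurable (lebesgue_on {0..})"
    using assms(1) by (rule continuous_imp_measurable_on_sets_lebesgue) simp
  show "(\<lambda>t. B * exp (- c * t)) integrable_on {0..}"
    using integrable_on_exp_minus_to_infinity[of c 0] assms(2) by (intro integrable_on_mult_right) auto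
qed (use assms in auto)

text \<open>Absolute integrability makes the integrals over \<open>{0..y}\<close> converge to the
  integral over \<open>{0..}\<close>. Existence of the limit of \<open>F\<close> is a conclusion
  here: for the rotation of the path, the limits of a primitive along two rays are not known
  beforehand.\<close>

lemma FTC_tendsto_at_top:
  fixes f :: "real \<Rightarrow> 'a::euclidean_space"
  assumes deriv: "\<And>t. t \<ge> 0 \<Longrightarrow> (F has_vector_derivative f t) (at t)"
    and int: "f absolutely_integrable_on {0..}"
  shows "(F \<longlongrightarrow> F 0 + integral {0..} f) at_top"
proof -
  have "((\<lambda>y. set_lebesgue_integral lebesgue {0..y} f) \<longlongrightarrow> set_lebesgue_integral lebesgue {0..} f) at_top"
    by (rule tendsto_set_lebesgue_integral_at_top) (use int in auto)
  also have "set_lebesgue_integral lebesgue {0..} f = integral {0..} f"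
    using int by (rule set_lebesgue_integral_eq_integral)
  finally have lim: "((\<lambda>y. F 0 + set_lebesgue_integral lebesgue {0..y} f) \<longlongrightarrow> F 0 + integral {0..} f) at_top"
    by (intro tendsto_intros)
  have "\<forall>\<^sub>F y in at_top. F 0 + set_lebesgue_integral lebesgue {0..y} f = F y"
    using eventually_ge_at_top[of 0]
  proof eventually_elim
    case (elim y)
    have "set_lebesgue_integral lebesgue {0..y} f = integral {0..y} f"
      by (rule set_lebesgue_integral_eq_integral, rule set_integrable_subset[OF int]) auto
    also have "\<dots> = F y - F 0"
      using elim deriv
      by (intro integral_unique fundamental_theorem_of_calculus) (auto intro: has_vector_derivative_at_within)
    finally show ?case by simp
  qed
  with lim show ?thesis by (simp cong: filterlim_cong)
qed

lemma FTC_integral_at_top: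
  fixes f :: "real \<Rightarrow> 'a::euclidean_space"
  assumes "\<And>t. t \<ge> 0 \<Longrightarrow> (F has_vector_derivative f t) (at t)"
    and "f absolutely_integrable_on {0..}" and "(F \<longlongrightarrow> L) at_top"
  shows "integral {0..} f = L - F 0"
  using tendsto_unique[OF _ FTC_tendsto_at_top[OF assms(1,2)] assms(3)] by (simp add: algebra_simps)

section \<open>Laplace integrals of powers\<close>

lemma power_times_exp_bounded:
  fixes c :: real
  assumes "c > 0"
  shows "\<exists>B. \<forall>t\<ge>0. t ^ k * exp (- c * t) \<le> B"
proof (intro exI allI impI)
  fix t :: real assume t: "t \<ge> 0"
  have "t ^ k * c ^ k / fact k \<le> exp (c * t)"
  proof -
    have "(c * t) ^ k / fact k \<le> exp (c * t)"
    proof -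
      \<comment> \<open>A single term of the exponential series is at most its sum, all terms being
        nonnegative.\<close>
      have "(\<Sum>n\<in>{k}. (c * t) ^ n /\<^sub>R fact n) \<le> (\<Sum>n. (c * t) ^ n /\<^sub>R fact n)"
        using assms t by (intro sum_le_suminf summable_exp_generic) auto
      thus ?thesis by (simp add: exp_def field_simps)
    qed
    thus ?thesis by (simp add: power_mult_distrib mult.commute)
  qed
  hence "t ^ k * c ^ k \<le> fact k * exp (c * t)" by (simp add: field_simps)
  thus "t ^ k * exp (- c * t) \<le> fact k / c ^ k"
    using assms by (simp add: exp_minus field_simps)
qed

lemma power_times_exp_tendsto_0:
  fixes c :: real
  assumes "c > 0"
  shows "((\<lambda>t. t ^ k * exp (- c * t)) \<longlongrightarrow> 0) at_top"
  using assms by real_asymp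

text \<open>Half of the decay rate \<open>Re \<mu>\<close> absorbs the power of \<open>t\<close>;
  the other half remains as an integrable majorant.\<close>

lemma absolutely_integrable_power_exp:
  fixes \<mu> :: complex
  assumes "Re \<mu> > 0"
  shows "(\<lambda>t. exp (- \<mu> * of_real t) * of_real t ^ k) absolutely_integrable_on {0..}"
proof -
  obtain B where B: "\<And>t. t \<ge> 0 \<Longrightarrow> t ^ k * exp (- (Re \<mu> / 2) * t) \<le> B"
    using power_times_exp_bounded[of "Re \<mu> / 2" k] assms by auto
  show ?thesis
  proof (rule absolutely_integrable_exp_bound[where B = B and c = "Re \<mu> / 2"])
    fix t :: real assume t: "t \<ge> 0"
    have "norm (exp (- \<mu> * of_real t) * of_real t ^ k) = (t ^ k * exp (- (Re \<mu> / 2) * t)) * exp (- (Re \<mu> / 2) * t)"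
      using t by (simp add: norm_mult norm_power flip: exp_add)
    also have "\<dots> \<le> B * exp (- (Re \<mu> / 2) * t)"
      using B[OF t] by (intro mult_right_mono) auto
    finally show "norm (exp (- \<mu> * of_real t) * of_real t ^ k) \<le> B * exp (- (Re \<mu> / 2) * t)" .
  qed (use assms in \<open>auto intro!: continuous_intros\<close>)
qed

text \<open>Induction by parts: the integral of the derivative of
  \<open>exp (- \<mu> t) t ^ Suc k\<close> vanishes. A complex \<open>\<mu>\<close> is allowed
  because rotating the path replaces \<open>l\<close> by \<open>l * \<omega>\<close>.\<close>

lemma integral_power_exp:
  fixes \<mu> :: complex
  assumes "Re \<mu> > 0"
  shows "integral {0..} (\<lambda>t. exp (- \<mu> * of_real t) * of_real t ^ k) = fact k / \<mu> ^ Suc k"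
proof (induction k)
  case 0
  have "integral {0..} (\<lambda>t. exp (- \<mu> * of_real t) * of_real t ^ 0) = 0 - (- exp (- \<mu> * of_real 0) / \<mu>)"
  proof (rule FTC_integral_at_top)
    show "((\<lambda>t. - exp (- \<mu> * of_real t) / \<mu>) has_vector_derivative exp (- \<mu> * of_real t) * of_real t ^ 0) (at t)" for t
      using assms by (auto intro!: derivative_eq_intros has_vector_derivative_real_field)
    have "((\<lambda>t. t ^ 0 * exp (- Re \<mu> * t) / norm \<mu>) \<longlongrightarrow> 0) at_top"
      by (rule tendsto_divide_zero[OF power_times_exp_tendsto_0[OF assms]])
    also have "(\<lambda>t. t ^ 0 * exp (- Re \<mu> * t) / norm \<mu>) = (\<lambda>t. norm (- exp (- \<mu> * of_real t) / \<mu>))"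
      by (simp add: norm_divide)
    finally show "((\<lambda>t. - exp (- \<mu> * of_real t) / \<mu>) \<longlongrightarrow> 0) at_top"
      by (rule tendsto_norm_zero_cancel)
  qed (rule absolutely_integrable_power_exp[OF assms])
  thus ?case by simp
next
  case (Suc k)
  let ?g = "\<lambda>k t. exp (- \<mu> * of_real t) * of_real t ^ k :: complex"
  note ai = absolutely_integrable_power_exp[OF assms]
  have "integral {0..} (\<lambda>t. of_nat (Suc k) * ?g k t - \<mu> * ?g (Suc k) t) = 0 - ?g (Suc k) 0"
  proof (rule FTC_integral_at_top)
    show "(?g (Suc k) has_vector_derivative (of_nat (Suc k) * ?g k t - \<mu> * ?g (Suc k) t)) (at t)" for t
      by (rule has_vector_derivative_real_field, (rule derivative_eq_intros refl)+) (simp add: algebra_simps)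
    have "((\<lambda>t. norm (?g (Suc k) t)) \<longlongrightarrow> 0) at_top"
    proof (rule Lim_transform_eventually[OF power_times_exp_tendsto_0[OF assms, of "Suc k"]])
      show "\<forall>\<^sub>F t in at_top. t ^ Suc k * exp (- Re \<mu> * t) = norm (?g (Suc k) t)"
        using eventually_ge_at_top[of 0] by eventually_elim (simp add: norm_mult norm_power)
    qed
    thus "(?g (Suc k) \<longlongrightarrow> 0) at_top" by (rule tendsto_norm_zero_cancel)
    show "(\<lambda>t. of_nat (Suc k) * ?g k t - \<mu> * ?g (Suc k) t) absolutely_integrable_on {0..}"
      by (intro set_integral_diff set_integrable_mult_right ai)
  qed
  also have "integral {0..} (\<lambda>t. of_nat (Suc k) * ?g k t - \<mu> * ?g (Suc k) t)
      = of_nat (Suc k) * integral {0..} (?g k) - \<mu> * integral {0..} (?g (Suc k))"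
    using ai[of k] ai[of "Suc k"]
    by (subst integral_diff) (simp_all only: integral_mult_right set_lebesgue_integral_eq_integral(1) set_integrable_mult_right)
  finally have "\<mu> * integral {0..} (?g (Suc k)) = of_nat (Suc k) * (fact k / \<mu> ^ Suc k)"
    using Suc by simp
  moreover have "\<mu> \<noteq> 0" using assms by auto
  ultimately have "integral {0..} (?g (Suc k)) = of_nat (Suc k) * (fact k / \<mu> ^ Suc k) / \<mu>"
    by (metis nonzero_mult_div_cancel_left)
  thus ?case by (simp add: mult.commute)
qed

text \<open>The substitution \<open>s = t^2 / 2\<close> turns Euler's integral for Gamma at
  \<open>(p + 1) / 2\<close> into a constant multiple of this one.\<close>

lemma powr_gaussian_integral:
  fixes p :: complex
  assumes p: "Re p > -1"
  shows "(\<lambda>t. of_real t powr p * exp (- (of_real t)\<^sup>2 / 2)) absolutely_integrable_on {0..}" (is ?ai)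
    and "integral {0..} (\<lambda>t. of_real t powr p * exp (- (of_real t)\<^sup>2 / 2)) = 2 powr ((p - 1) / 2) * Gamma ((p + 1) / 2)" (is ?int)
proof -
  define z where "z = (p + 1) / 2"
  have z: "Re z > 0" using p by (simp add: z_def)
  define f where "f = (\<lambda>t. complex_of_real t powr (z - 1) / of_real (exp t))"
  define h where "h = (\<lambda>t::real. of_real t powr p * exp (- (of_real t)\<^sup>2 / 2) :: complex)"
  define c :: complex where "c = 2 powr (1 - z)"
  have img: "(\<lambda>t::real. t\<^sup>2 / 2) ` {0<..} = {0<..}"
  proof (intro equalityI subsetI)
    fix x :: real assume "x \<in> {0<..}"
    hence "x = (sqrt (2 * x))\<^sup>2 / 2" "sqrt (2 * x) \<in> {0<..}" by auto
    thus "x \<in> (\<lambda>t::real. t\<^sup>2 / 2) ` {0<..}" by blast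
  qed auto
  have inj: "inj_on (\<lambda>t::real. t\<^sup>2 / 2) {0<..}" by (auto simp: inj_on_def)
  \<comment> \<open>Jacobian times substituted Gamma integrand. Every power is written as an
    exponential of real logarithms, so no branch of the complex power interferes.\<close>
  have fh: "of_real t * f (t\<^sup>2 / 2) = c * h t" if "t > 0" for t
  proof -
    have "ln (t\<^sup>2 / 2) = 2 * ln t - ln 2" using that by (simp add: ln_div ln_realpow)
    moreover have "t\<^sup>2 / 2 > 0" using that by simp
    hence "complex_of_real (t\<^sup>2 / 2) powr (z - 1) = exp ((z - 1) * of_real (ln (t\<^sup>2 / 2)))"
      by (simp only: powr_def Ln_of_real) auto
    ultimately have "complex_of_real (t\<^sup>2 / 2) powr (z - 1) = exp ((z - 1) * (2 * of_real (ln t) - of_real (ln 2)))"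
      by simp
    hence 1: "complex_of_real (t\<^sup>2 / 2) powr (z - 1) = exp ((z - 1) * (2 * of_real (ln t) - of_real (ln 2)))" .
    have 2: "complex_of_real t = exp (of_real (ln t))" using that by (simp flip: of_real_exp)
    have 3: "c = exp ((1 - z) * of_real (ln 2))"
      using Ln_of_real[of 2] by (simp add: c_def powr_def)
    have 4: "of_real t powr p = exp ((2 * z - 1) * of_real (ln t))"
      using that by (simp add: powr_def Ln_of_real z_def add_divide_distrib)
    have 5: "inverse (complex_of_real (exp (t\<^sup>2 / 2))) = exp (- (of_real t)\<^sup>2 / 2)"
      by (simp add: exp_minus of_real_exp)
    have "of_real t * f (t\<^sup>2 / 2) = exp (of_real (ln t)) * (exp ((z - 1) * (2 * of_real (ln t) - of_real (ln 2))) * exp (- (of_real t)\<^sup>2 / 2))"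
      unfolding f_def divide_inverse[of "_ powr _"] 1 5 by (subst 2) (rule refl)
    also have "\<dots> = (exp (of_real (ln t)) * exp ((z - 1) * (2 * of_real (ln t) - of_real (ln 2)))) * exp (- (of_real t)\<^sup>2 / 2)"
      by (simp only: mult.assoc)
    also have "exp (of_real (ln t)) * exp ((z - 1) * (2 * of_real (ln t) - of_real (ln 2))) = c * of_real t powr p"
      unfolding 3 4 exp_add[symmetric] by (rule arg_cong[of _ _ exp]) (simp only: algebra_simps mult_2_right mult_2, simp)
    finally show ?thesis by (simp only: h_def mult.assoc)
  qed
  have f: "f absolutely_integrable_on {0<..}" "(f has_integral Gamma z) {0<..}"
    unfolding f_def by (rule absolutely_integrable_Gamma_integral'[OF z], rule Gamma_integral_complex'[OF z])
  \<comment> \<open>The substitution is made for real functions and applied to the real and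
    imaginary parts of \<open>f\<close>.\<close>
  have cov: "(\<lambda>t. t * g (t\<^sup>2 / 2)) absolutely_integrable_on {0<..} \<and>
      integral {0<..} (\<lambda>t. t * g (t\<^sup>2 / 2)) = integral {0<..} g"
    if "g absolutely_integrable_on {0<..}" for g :: "real \<Rightarrow> real"
  proof -
    have "(\<lambda>t. \<bar>t\<bar> * g (t\<^sup>2 / 2)) absolutely_integrable_on {0<..} \<and>
        integral {0<..} (\<lambda>t. \<bar>t\<bar> * g (t\<^sup>2 / 2)) = integral {0<..} g"
    proof -
      have "((\<lambda>t. t\<^sup>2 / 2) has_field_derivative t) (at t within {0<..})" for t :: real
        by (auto intro!: derivative_eq_intros)
      from has_absolute_integral_change_of_variables_1'[OF _ this inj, of g "integral {0<..} g"]
      show ?thesis using that unfolding img by simp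
    qed
    moreover have "(\<lambda>t. \<bar>t\<bar> * g (t\<^sup>2 / 2)) absolutely_integrable_on {0<..} \<longleftrightarrow>
        (\<lambda>t. t * g (t\<^sup>2 / 2)) absolutely_integrable_on {0<..}"
      by (rule set_integrable_cong) auto
    moreover have "integral {0<..} (\<lambda>t. \<bar>t\<bar> * g (t\<^sup>2 / 2)) = integral {0<..} (\<lambda>t. t * g (t\<^sup>2 / 2))"
      by (rule integral_cong) auto
    ultimately show ?thesis by simp
  qed
  have re: "(\<lambda>t. Re (f t)) absolutely_integrable_on {0<..}" "integral {0<..} (\<lambda>t. Re (f t)) = Re (Gamma z)"
    using absolutely_integrable_linear[OF f(1) bounded_linear_Re] has_integral_linear[OF f(2) bounded_linear_Re]
    by (simp_all add: o_def has_integral_iff)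
  have im: "(\<lambda>t. Im (f t)) absolutely_integrable_on {0<..}" "integral {0<..} (\<lambda>t. Im (f t)) = Im (Gamma z)"
    using absolutely_integrable_linear[OF f(1) bounded_linear_Im] has_integral_linear[OF f(2) bounded_linear_Im]
    by (simp_all add: o_def has_integral_iff)
  define q where "q = (\<lambda>t. of_real t * f (t\<^sup>2 / 2))"
  have Req: "(\<lambda>t. Re (q t)) absolutely_integrable_on {0<..}" "integral {0<..} (\<lambda>t. Re (q t)) = Re (Gamma z)"
    using cov[OF re(1)] re(2) by (simp_all add: q_def)
  have Imq: "(\<lambda>t. Im (q t)) absolutely_integrable_on {0<..}" "integral {0<..} (\<lambda>t. Im (q t)) = Im (Gamma z)"
    using cov[OF im(1)] im(2) by (simp_all add: q_def)
  have q: "q absolutely_integrable_on {0<..}"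
    using Req(1) Imq(1) 
    by (subst absolutely_integrable_componentwise_iff) (auto simp: Basis_complex_def)
  have qi: "integral {0<..} q = Gamma z"
    using integral_linear[OF set_lebesgue_integral_eq_integral(1)[OF q] bounded_linear_Re]
      integral_linear[OF set_lebesgue_integral_eq_integral(1)[OF q] bounded_linear_Im] Req(2) Imq(2)
    by (intro complex_eqI) (simp_all only: o_def)
  have c0: "c \<noteq> 0" by (simp add: c_def)
  have hq: "h t = inverse c * q t" if "t > 0" for t
    using fh[OF that] c0 by (simp add: q_def)
  have "h absolutely_integrable_on {0<..} \<longleftrightarrow> (\<lambda>t. inverse c * q t) absolutely_integrable_on {0<..}"
    by (rule set_integrable_cong) (simp_all add: hq)
  hence h1: "h absolutely_integrable_on {0<..}"
    using set_integrable_mult_right[OF q, of "inverse c"] by simp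
  have h2: "integral {0<..} h = inverse c * Gamma z"
  proof -
    have "integral {0<..} h = integral {0<..} (\<lambda>t. inverse c * q t)" by (rule integral_cong) (auto simp: hq)
    thus ?thesis by (simp add: qi)
  qed
  \<comment> \<open>The substitution lives on the open half line; adding the null set
    \<open>{0}\<close> gives the closed one.\<close>
  have "(h has_integral inverse c * Gamma z) {0<..}"
    using h1 h2 by (simp add: has_integral_iff set_lebesgue_integral_eq_integral)
  hence "(h has_integral inverse c * Gamma z) {0..}"
    by (subst (asm) has_integral_spike_set_eq[where T = "{0..}"]) (auto intro: negligible_subset[of "{0}"])
  moreover have "inverse c = 2 powr ((p - 1) / 2)"
  proof -
    have "(p - 1) / 2 = - (1 - z)" by (simp add: z_def field_simps)
    thus ?thesis by (simp only: c_def powr_minus)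
  qed
  ultimately show ?int by (simp add: h_def z_def integral_unique)
  have "h absolutely_integrable_on ({0} \<union> {0<..})"
    by (intro set_integrable_Un h1 absolutely_integrable_negligible) auto
  also have "{0} \<union> {0<..} = {0::real..}" by auto
  finally show ?ai by (simp add: h_def)
qed

section \<open>Gamma function asymptotics\<close>

lemma of_nat_powr_complex: "n > 0 \<Longrightarrow> (of_nat n :: complex) powr w = exp (w * of_real (ln (real n)))"
  using Ln_of_real[of "real n"] by (simp add: powr_def)

lemma pochhammer_asymp:
  "(\<lambda>n. pochhammer z (n + 1) / (fact n * of_nat n powr z)) \<longlonglongrightarrow> rGamma (z :: complex)"
proof (rule Lim_transform_eventually[OF rGamma_series_LIMSEQ])
  show "\<forall>\<^sub>F n in sequentially. rGamma_series z n = pochhammer z (n + 1) / (fact n * of_nat n powr z)"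
    using eventually_gt_at_top[of 0] by eventually_elim (simp add: rGamma_series_def of_nat_powr_complex)
qed

text \<open>For \<open>Re z > 0\<close> this is Euler's limit formula combined with
  \<open>Gamma (z + n) = Gamma z * pochhammer z n\<close>. Every other \<open>z\<close>, poles of
  Gamma included, is reached by descending from \<open>z + 1\<close> to \<open>z\<close>.\<close>

lemma Gamma_shift_asymp:
  "(\<lambda>n. Gamma (z + of_nat n) / (fact n * of_nat n powr (z - 1))) \<longlonglongrightarrow> (1 :: complex)"
proof -
  \<comment> \<open>\<open>Gamma (z + 1 + n)\<close> is \<open>Gamma (z + Suc n)\<close>, so the
    descent is a shift of the index; the two denominators differ by the factor
    \<open>(n / Suc n) powr z\<close>, which tends to 1.\<close>
  have step: "(\<lambda>n. Gamma (z + of_nat n) / (fact n * of_nat n powr (z - 1))) \<longlonglongrightarrow> 1"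
    if "(\<lambda>n. Gamma (z + 1 + of_nat n) / (fact n * of_nat n powr (z + 1 - 1))) \<longlonglongrightarrow> 1" for z :: complex
  proof -
    have "(\<lambda>n. (of_nat n / of_nat (Suc n) :: complex) powr z) \<longlonglongrightarrow> 1 powr z"
      by (intro tendsto_powr_complex LIMSEQ_n_over_Suc_n tendsto_const) auto
    from tendsto_mult[OF that this]
    have "(\<lambda>n. Gamma (z + 1 + of_nat n) / (fact n * of_nat n powr (z + 1 - 1)) * (of_nat n / of_nat (Suc n)) powr z) \<longlonglongrightarrow> 1"
      by simp
    moreover have "\<forall>\<^sub>F n in sequentially. Gamma (z + 1 + of_nat n) / (fact n * of_nat n powr (z + 1 - 1)) * (of_nat n / of_nat (Suc n)) powr z
       = Gamma (z + of_nat (Suc n)) / (fact (Suc n) * of_nat (Suc n) powr (z - 1))"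
      using eventually_gt_at_top[of 0]
    proof eventually_elim
      case (elim n)
      define y where "y = real n / real (Suc n)"
      have y: "y > 0" using elim by (simp add: y_def)
      have "(of_nat n / of_nat (Suc n) :: complex) = of_real y" by (simp add: y_def)
      hence "(of_nat n / of_nat (Suc n) :: complex) powr z = exp (z * of_real (ln y))"
        using y by (simp only: powr_def Ln_of_real) auto
      also have "ln y = ln (real n) - ln (real (Suc n))"
        unfolding y_def using elim by (simp add: ln_div del: of_nat_Suc)
      also have "exp (z * of_real (ln (real n) - ln (real (Suc n)))) = (of_nat n powr z / of_nat (Suc n) powr z :: complex)"
      proof -
        have "z * of_real (ln (real n) - ln (real (Suc n))) = z * of_real (ln (real n)) - z * of_real (ln (real (Suc n)))"
          by (simp only: of_real_diff right_diff_distrib)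
        thus ?thesis using elim by (simp only: of_nat_powr_complex exp_diff zero_less_Suc)
      qed
      finally have "(of_nat n / of_nat (Suc n) :: complex) powr z = of_nat n powr z / of_nat (Suc n) powr z" .
      moreover have "(of_nat (Suc n) :: complex) powr (z - 1) = of_nat (Suc n) powr z / of_nat (Suc n)"
        by (simp add: powr_diff del: of_nat_Suc)
      moreover have "z + 1 + of_nat n = z + of_nat (Suc n)" "z + 1 - 1 = z" by simp_all
      moreover have "G / (F * N) * (N / S') = G / (S * F * (S' / S))" if "N \<noteq> 0" "S \<noteq> 0" for G F N S S' :: complex
        using that by simp
      ultimately show ?case using elim by (simp only: fact_Suc of_nat_mult) simp
    qed
    ultimately have "(\<lambda>n. Gamma (z + of_nat (Suc n)) / (fact (Suc n) * of_nat (Suc n) powr (z - 1))) \<longlonglongrightarrow> 1"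
      by (rule Lim_transform_eventually)
    thus ?thesis by (rule LIMSEQ_imp_Suc)
  qed
  have base: "(\<lambda>n. Gamma (z + of_nat n) / (fact n * of_nat n powr (z - 1))) \<longlonglongrightarrow> 1" if "Re z > 0" for z :: complex
  proof -
    have z: "z \<notin> \<int>\<^sub>\<le>\<^sub>0" using that by (auto elim!: nonpos_Ints_cases)
    have "(\<lambda>n. Gamma z / Gamma_series' z n) \<longlonglongrightarrow> Gamma z / Gamma z"
      using z by (intro tendsto_intros Gamma_series'_LIMSEQ) (auto simp: Gamma_eq_zero_iff)
    moreover have "\<forall>\<^sub>F n in sequentially. Gamma z / Gamma_series' z n = Gamma (z + of_nat n) / (fact n * of_nat n powr (z - 1))"
      using eventually_gt_at_top[of 0]
    proof eventually_elim
      case (elim n)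
      have "fact n = of_nat n * (fact (n - 1) :: complex)" using elim by (simp add: fact_reduce)
      moreover have "of_nat n powr (z - 1) = of_nat n powr z / (of_nat n :: complex)"
        using elim by (simp add: powr_diff)
      moreover have "Gamma (z + of_nat n) = Gamma z * pochhammer z n"
        using z by (simp add: pochhammer_Gamma Gamma_eq_zero_iff)
      ultimately show ?case using elim by (simp add: Gamma_series'_def of_nat_powr_complex)
    qed
    ultimately have "(\<lambda>n. Gamma (z + of_nat n) / (fact n * of_nat n powr (z - 1))) \<longlonglongrightarrow> Gamma z / Gamma z"
      by (rule Lim_transform_eventually)
    thus ?thesis using z by (simp add: Gamma_eq_zero_iff)
  qed
  \<comment> \<open>\<open>k\<close> descents lead from the right half plane to
    \<open>z\<close>.\<close>
  obtain k :: nat where "- Re z < real k" using reals_Archimedean2 by blast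
  hence k: "Re z + real k > 0" by linarith
  from k show ?thesis
  proof (induction k arbitrary: z)
    case 0
    thus ?case using base by simp
  next
    case (Suc k)
    show ?case by (rule step, rule Suc.IH) (use Suc.prems in simp)
  qed
qed

text \<open>Wallis' limit, read off from Euler's product at 1/2, where
  \<open>pochhammer (1/2) n = (2n)! / (4^n n!)\<close> and \<open>Gamma (1/2) = sqrt pi\<close>. The
  auxiliary factor \<open>1 + 1 / (2 n)\<close> replaces the last Pochhammer factor
  \<open>1/2 + n\<close> by \<open>n\<close>.\<close>

lemma central_binomial_asymp:
  "(\<lambda>n. 4 ^ n * (fact n)\<^sup>2 / (fact (2 * n) * sqrt (real n))) \<longlonglongrightarrow> sqrt pi"
proof -
  have "(\<lambda>n. inverse (rGamma_series (1/2) n) * (1 + 1 / (2 * real n))) \<longlonglongrightarrow> inverse (rGamma (1/2)) * (1 + 0 :: real)"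
  proof (intro tendsto_intros)
    show "(\<lambda>n. 1 / (2 * real n)) \<longlonglongrightarrow> 0" by real_asymp
  qed (auto simp: rGamma_eq_zero_iff elim!: nonpos_Ints_cases')
  hence "(\<lambda>n. inverse (rGamma_series (1/2) n) * (1 + 1 / (2 * real n))) \<longlonglongrightarrow> sqrt pi"
    by (simp add: rGamma_inverse_Gamma Gamma_one_half_real)
  moreover have "\<forall>\<^sub>F n in sequentially. inverse (rGamma_series (1/2) n) * (1 + 1 / (2 * real n)) = 4 ^ n * (fact n)\<^sup>2 / (fact (2 * n) * sqrt (real n))"
    using eventually_gt_at_top[of 0]
  proof eventually_elim
    case (elim n)
    have "ln (real n) / 2 = ln (sqrt (real n))"
      using elim by (simp add: ln_sqrt)
    hence "exp (ln (real n) / 2) = sqrt (real n)"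
      using elim by (simp only: exp_ln) simp
    hence "rGamma_series (1/2) n = pochhammer (1/2) n * (1/2 + n) / (fact n * sqrt n)"
      by (simp add: rGamma_series_def pochhammer_Suc)
    moreover have "pochhammer (1/2) n = fact (2 * n) / (4 ^ n * fact n :: real)"
      by (simp add: fact_double power_mult)
    ultimately have A: "rGamma_series (1/2) n = fact (2 * n) * (1/2 + real n) / (4 ^ n * fact n * fact n * sqrt (real n))"
      by simp
    have B: "1 + 1 / (2 * real n) = (1/2 + real n) / (sqrt (real n) * sqrt (real n))"
      using elim by (simp add: add_divide_distrib)
    have C: "inverse (P * h / (Y * F * F * S)) * (h / (S * S)) = Y * F\<^sup>2 / (P * S)"
      if "h > 0" "S > 0" "F > 0" "Y > 0" "P > 0" for Y F S h P :: real
      using that by (simp add: power2_eq_square)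
    show ?case
      unfolding A B by (rule C) (use elim in \<open>simp_all add: add_pos_nonneg\<close>)
  qed
  ultimately show ?thesis by (rule Lim_transform_eventually)
qed

section \<open>Moments of large order\<close>

text \<open>Large moments only see the behaviour of the functions near infinity.\<close>

lemma moment_ratio_tendsto_0:
  fixes d :: "real \<Rightarrow> complex" and w :: "real \<Rightarrow> real"
  assumes w0: "\<And>t. t \<ge> 0 \<Longrightarrow> w t \<ge> 0" and wpos: "\<And>t. t > 0 \<Longrightarrow> w t > 0"
    and cont: "continuous_on {0<..} w"
    and intw: "\<And>n. n \<ge> m \<Longrightarrow> (\<lambda>t. t ^ n * w t) integrable_on {0..}"
    and intd: "\<And>n. n \<ge> m \<Longrightarrow> (\<lambda>t. of_real t ^ n * d t) absolutely_integrable_on {0..}"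
    and lim: "((\<lambda>t. norm (d t) / w t) \<longlongrightarrow> 0) at_top"
  shows "(\<lambda>n. norm (integral {0..} (\<lambda>t. of_real t ^ n * d t)) / integral {0..} (\<lambda>t. t ^ n * w t)) \<longlonglongrightarrow> 0"
proof (rule order_tendstoI)
  fix \<epsilon> :: real assume "\<epsilon> < 0"
  have "0 \<le> integral {0..} (\<lambda>t. t ^ n * w t)" for n
  proof (cases "(\<lambda>t. t ^ n * w t) integrable_on {0..}")
    case True
    thus ?thesis by (rule integral_nonneg) (simp add: w0)
  qed (simp add: not_integrable_integral)
  hence nn: "0 \<le> norm (integral {0..} (\<lambda>t. of_real t ^ n * d t)) / integral {0..} (\<lambda>t. t ^ n * w t)" for n
    by simp
  from less_le_trans[OF \<open>\<epsilon> < 0\<close> nn] show "\<forall>\<^sub>F n in sequentially. \<epsilon> < norm (integral {0..} (\<lambda>t. of_real t ^ n * d t)) / integral {0..} (\<lambda>t. t ^ n * w t)"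
    by (rule always_eventually[OF allI])
next
  fix \<epsilon> :: real assume \<epsilon>: "0 < \<epsilon>"
  have "\<forall>\<^sub>F t in at_top. norm (d t) / w t < \<epsilon> / 2"
    using lim \<epsilon> by (intro order_tendstoD(2)) auto
  then obtain T0 where T0: "\<And>t. t \<ge> T0 \<Longrightarrow> norm (d t) / w t < \<epsilon> / 2"
    by (auto simp: eventually_at_top_linorder)
  define T where "T = max T0 1"
  have T: "T \<ge> 1" by (simp add: T_def)
  have dT: "norm (d t) \<le> \<epsilon> / 2 * w t" if "t \<ge> T" for t
  proof -
    have "norm (d t) / w t < \<epsilon> / 2" "w t > 0" using that T0[of t] wpos[of t] by (simp_all add: T_def)
    thus ?thesis by (simp add: field_simps)
  qed
  \<comment> \<open>On this interval, away from \<open>[0, T]\<close>, the weight alone gives a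
    moment of at least \<open>(2 T) ^ (n - m)\<close> times the positive minimum
    \<open>\<kappa>\<close>, whereas \<open>[0, T]\<close> contributes only the order of
    \<open>T ^ (n - m)\<close>. Hence the geometric factor \<open>(1/2) ^ (n - m)\<close>
    below.\<close>
  have "continuous_on {2 * T..2 * T + 1} (\<lambda>t. t ^ m * w t)"
    using T by (intro continuous_intros continuous_on_subset[OF cont]) auto
  then obtain t0 where t0: "t0 \<in> {2 * T..2 * T + 1}" "\<And>t. t \<in> {2 * T..2 * T + 1} \<Longrightarrow> t0 ^ m * w t0 \<le> t ^ m * w t"
    using continuous_attains_inf[of "{2 * T..2 * T + 1}" "\<lambda>t. t ^ m * w t"] by auto
  define \<kappa> where "\<kappa> = t0 ^ m * w t0"
  have \<kappa>: "\<kappa> > 0" using t0(1) T by (auto simp: \<kappa>_def intro!: mult_pos_pos wpos)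
  \<comment> \<open>Convergence is assumed from order \<open>m\<close> on, so \<open>m\<close>
    powers of \<open>t\<close> stay inside the integral and only \<open>n - m\<close> are
    estimated.\<close>
  define D where "D = integral {0..} (\<lambda>t. t ^ m * norm (d t))"
  have intD: "(\<lambda>t. t ^ m * norm (d t)) integrable_on {0..}"
  proof -
    have "(\<lambda>t. norm (of_real t ^ m * d t)) integrable_on {0..}"
      using intd[of m] by (simp add: absolutely_integrable_on_def)
    thus ?thesis by (rule integrable_eq) (simp add: norm_mult norm_power)
  qed
  have W: "(2 * T) ^ (n - m) * \<kappa> \<le> integral {0..} (\<lambda>t. t ^ n * w t)" if n: "n \<ge> m" for n
  proof -
    have "(2 * T) ^ (n - m) * \<kappa> = integral {2 * T..2 * T + 1} (\<lambda>t. (2 * T) ^ (n - m) * \<kappa>)" by simp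
    also have "\<dots> \<le> integral {2 * T..2 * T + 1} (\<lambda>t. t ^ n * w t)"
    proof (rule integral_le)
      show "(\<lambda>t. t ^ n * w t) integrable_on {2 * T..2 * T + 1}"
        using T by (intro integrable_continuous_real continuous_intros continuous_on_subset[OF cont]) auto
      fix t assume t: "t \<in> {2 * T..2 * T + 1}"
      have "(2 * T) ^ (n - m) * \<kappa> \<le> t ^ (n - m) * (t ^ m * w t)"
        using t T t0(2)[OF t] \<kappa> by (intro mult_mono power_mono) (auto simp: \<kappa>_def)
      also have "\<dots> = t ^ n * w t" using n by (simp add: mult.assoc[symmetric] flip: power_add)
      finally show "(2 * T) ^ (n - m) * \<kappa> \<le> t ^ n * w t" .
    qed auto
    also have "\<dots> \<le> integral {0..} (\<lambda>t. t ^ n * w t)"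
      using T by (intro integral_subset_le intw n integrable_continuous_real continuous_intros continuous_on_subset[OF cont])
                 (auto intro!: w0 mult_nonneg_nonneg)
    finally show ?thesis .
  qed
  \<comment> \<open>The majorant adds two terms valid on all of \<open>t \<ge> 0\<close>: the first
    dominates for \<open>t < T\<close>, the second for \<open>t \<ge> T\<close>.\<close>
  have main: "norm (integral {0..} (\<lambda>t. of_real t ^ n * d t)) / integral {0..} (\<lambda>t. t ^ n * w t) \<le> D / \<kappa> * (1/2) ^ (n - m) + \<epsilon> / 2"
    if n: "n \<ge> m" for n
  proof -
    let ?W = "integral {0..} (\<lambda>t. t ^ n * w t)"
    have D0: "D \<ge> 0" unfolding D_def by (rule integral_nonneg[OF intD]) auto
    have "(2 * T) ^ (n - m) * \<kappa> > 0" using T \<kappa> by simp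
    hence Wpos: "?W > 0" using W[OF n] by linarith
    have "norm (integral {0..} (\<lambda>t. of_real t ^ n * d t)) \<le> integral {0..} (\<lambda>t. T ^ (n - m) * (t ^ m * norm (d t)) + \<epsilon> / 2 * (t ^ n * w t))"
    proof (rule integral_norm_bound_integral)
      show "(\<lambda>t. of_real t ^ n * d t) integrable_on {0..}" using intd[OF n] by (rule set_lebesgue_integral_eq_integral(1))
      show "(\<lambda>t. T ^ (n - m) * (t ^ m * norm (d t)) + \<epsilon> / 2 * (t ^ n * w t)) integrable_on {0..}"
        by (intro integrable_add integrable_on_mult_right intD intw n)
      fix t :: real assume "t \<in> {0..}"
      hence t: "t \<ge> 0" by simp
      show "norm (of_real t ^ n * d t) \<le> T ^ (n - m) * (t ^ m * norm (d t)) + \<epsilon> / 2 * (t ^ n * w t)"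
      proof (cases "t \<ge> T")
        case True
        have "norm (of_real t ^ n * d t) = t ^ n * norm (d t)" using t by (simp add: norm_mult norm_power)
        also have "\<dots> \<le> t ^ n * (\<epsilon> / 2 * w t)" using dT[OF True] t by (intro mult_left_mono) auto
        also have "\<dots> = 0 + \<epsilon> / 2 * (t ^ n * w t)" by simp
        also have "\<dots> \<le> T ^ (n - m) * (t ^ m * norm (d t)) + \<epsilon> / 2 * (t ^ n * w t)"
          using T t by (intro add_right_mono) simp
        finally show ?thesis .
      next
        case False
        have "norm (of_real t ^ n * d t) = t ^ (n - m) * (t ^ m * norm (d t))"
          using t n by (simp add: norm_mult norm_power mult.assoc[symmetric] flip: power_add)
        also have "\<dots> \<le> T ^ (n - m) * (t ^ m * norm (d t)) + 0"
          using False t by (simp add: mult_right_mono power_mono)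
        also have "\<dots> \<le> T ^ (n - m) * (t ^ m * norm (d t)) + \<epsilon> / 2 * (t ^ n * w t)"
          using \<epsilon> t w0[OF t] by (intro add_left_mono) simp
        finally show ?thesis .
      qed
    qed
    also have "\<dots> = T ^ (n - m) * D + \<epsilon> / 2 * ?W"
      unfolding D_def
      by (subst integral_add) (simp_all only: integral_mult_right integrable_on_mult_right intD intw n)
    finally have "norm (integral {0..} (\<lambda>t. of_real t ^ n * d t)) / ?W \<le> (T ^ (n - m) * D + \<epsilon> / 2 * ?W) / ?W"
      using Wpos by (intro divide_right_mono) auto
    also have "\<dots> = T ^ (n - m) * D / ?W + \<epsilon> / 2" using Wpos by (simp add: add_divide_distrib)
    also have "T ^ (n - m) * D / ?W \<le> T ^ (n - m) * D / ((2 * T) ^ (n - m) * \<kappa>)"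
      using W[OF n] D0 T \<kappa> Wpos by (intro divide_left_mono) auto
    also have "\<dots> = D / \<kappa> * (1/2) ^ (n - m)"
      using T by (simp add: power_mult_distrib power_one_over)
    finally show ?thesis by simp
  qed
  have "(\<lambda>n. D / \<kappa> * (1/2) ^ n + \<epsilon> / 2) \<longlonglongrightarrow> D / \<kappa> * 0 + \<epsilon> / 2"
    by (intro tendsto_intros LIMSEQ_power_zero) auto
  hence "\<forall>\<^sub>F n in sequentially. D / \<kappa> * (1/2) ^ n + \<epsilon> / 2 < \<epsilon>"
    by (rule order_tendstoD(2)) (use \<epsilon> in simp)
  then obtain N where N: "\<And>n. n \<ge> N \<Longrightarrow> D / \<kappa> * (1/2) ^ n + \<epsilon> / 2 < \<epsilon>"
    by (auto simp: eventually_at_top_linorder)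
  show "\<forall>\<^sub>F n in sequentially. norm (integral {0..} (\<lambda>t. of_real t ^ n * d t)) / integral {0..} (\<lambda>t. t ^ n * w t) < \<epsilon>"
    using eventually_ge_at_top[of "N + m"]
  proof eventually_elim
    case (elim n)
    have "norm (integral {0..} (\<lambda>t. of_real t ^ n * d t)) / integral {0..} (\<lambda>t. t ^ n * w t) \<le> D / \<kappa> * (1/2) ^ (n - m) + \<epsilon> / 2"
      using elim by (intro main) auto
    also have "\<dots> < \<epsilon>" using elim by (intro N) auto
    finally show ?case .
  qed
qed

section \<open>Gaussian moments with a complex exponent\<close>

lemma powr_gaussian_moment:
  fixes b :: complex
  assumes "n \<ge> 1" "real n + Re b > -1"
  shows "(\<lambda>t. of_real t ^ n * (of_real t powr b * exp (- (of_real t)\<^sup>2 / 2))) absolutely_integrable_on {0..}" (is ?ai)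
    and "integral {0..} (\<lambda>t. of_real t ^ n * (of_real t powr b * exp (- (of_real t)\<^sup>2 / 2)))
      = 2 powr ((of_nat n + b - 1) / 2) * Gamma ((of_nat n + b + 1) / 2)" (is ?int)
proof -
  have eq: "of_real t ^ n * (of_real t powr b * exp (- (of_real t)\<^sup>2 / 2)) = of_real t powr (of_nat n + b) * exp (- (of_real t)\<^sup>2 / 2)" for t :: real
    using assms(1) by (cases "t = 0") (auto simp: powr_add)
  have p: "Re (of_nat n + b) > -1" using assms(2) by simp
  show ?ai ?int unfolding eq by (rule powr_gaussian_integral[OF p])+
qed

text \<open>The elementary asymptotic form of the Gaussian moments of order \<open>2 n + i\<close>. Its modulus depends
  only on \<open>Re a\<close>, which lets complex moments be compared with moments of a positive weight.\<close>

definition moment_scale :: "complex \<Rightarrow> nat \<Rightarrow> nat \<Rightarrow> complex" where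
  "moment_scale a i n = 2 powr (of_nat i / 2 - a / 2 - 3 / 4) * 2 ^ n *
     (fact n * of_nat n powr (of_nat i / 2 + 1 / 4 - a / 2 - 1))"

lemma norm_moment_scale: "n > 0 \<Longrightarrow> norm (moment_scale (of_real (Re a)) i n) = norm (moment_scale a i n)"
  by (simp add: moment_scale_def norm_mult norm_power norm_powr_real)

text \<open>Raising the order by 2 raises the argument of Gamma by 1, so the exact value at order
  \<open>2 n + i\<close> contains \<open>Gamma (z + n)\<close> with a fixed \<open>z\<close>, and
  \<open>Gamma_shift_asymp\<close> applies.\<close>

lemma powr_gaussian_moment_asymp:
  fixes a :: complex
  defines "J \<equiv> \<lambda>n. integral {0..} (\<lambda>t. of_real t ^ n * (of_real t powr (- a - 1/2) * exp (- (of_real t)\<^sup>2 / 2)))"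
  shows "(\<lambda>n. J (2 * n + i) / moment_scale a i n) \<longlonglongrightarrow> 1"
proof -
  define z where "z = of_nat i / 2 + 1 / 4 - a / 2"
  define n0 where "n0 = nat \<lceil>\<bar>Re a\<bar>\<rceil> + 1"
  have "\<forall>\<^sub>F n in sequentially. Gamma (z + of_nat n) / (fact n * of_nat n powr (z - 1)) = J (2 * n + i) / moment_scale a i n"
    using eventually_ge_at_top[of n0]
  proof eventually_elim
    case (elim n)
    have n: "real n \<ge> \<bar>Re a\<bar>" "n \<ge> 1" using elim unfolding n0_def by linarith+
    have "J (2 * n + i) = 2 powr ((of_nat (2 * n + i) + (- a - 1/2) - 1) / 2) * Gamma ((of_nat (2 * n + i) + (- a - 1/2) + 1) / 2)"
      unfolding J_def by (rule powr_gaussian_moment(2)) (use n in auto)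
    also have "(of_nat (2 * n + i) + (- a - 1/2) + 1) / 2 = z + of_nat n" by (simp add: z_def field_simps)
    also have "(of_nat (2 * n + i) + (- a - 1/2) - 1) / 2 = (of_nat i / 2 - a / 2 - 3 / 4) + of_nat n" by (simp add: field_simps)
    also have "(2 :: complex) powr \<dots> = 2 powr (of_nat i / 2 - a / 2 - 3 / 4) * 2 ^ n" by (simp add: powr_add)
    finally show ?case by (simp add: moment_scale_def z_def)
  qed
  with Gamma_shift_asymp show ?thesis by (rule Lim_transform_eventually)
qed

section \<open>Gaussian decay in a wedge\<close>

text \<open>For \<open>m \<ge> 0\<close> the closed sector of half-angle \<open>arctan m\<close>
  around the positive real axis, with its vertex. Linear inequalities instead of \<open>Arg\<close>
  make convexity and scaling elementary.\<close>

definition wedge :: "real \<Rightarrow> complex set" where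
  "wedge m = {z. 0 \<le> Re z \<and> \<bar>Im z\<bar> \<le> m * Re z}"

lemma convex_wedge: "convex (wedge m)"
proof (rule convexI)
  fix x y :: complex and u v :: real
  assume "x \<in> wedge m" "y \<in> wedge m" and uv: "0 \<le> u" "0 \<le> v"
  hence "u * \<bar>Im x\<bar> \<le> u * (m * Re x)" "v * \<bar>Im y\<bar> \<le> v * (m * Re y)"
    by (auto simp: wedge_def intro!: mult_left_mono)
  moreover have "\<bar>u * Im x + v * Im y\<bar> \<le> u * \<bar>Im x\<bar> + v * \<bar>Im y\<bar>"
    using uv abs_triangle_ineq[of "u * Im x" "v * Im y"] by (simp add: abs_mult)
  moreover have "0 \<le> u * Re x + v * Re y"
    using \<open>x \<in> wedge m\<close> \<open>y \<in> wedge m\<close> uv by (simp add: wedge_def)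
  ultimately show "u *\<^sub>R x + v *\<^sub>R y \<in> wedge m"
    by (simp add: wedge_def algebra_simps)
qed

lemma wedge_scale: "z \<in> wedge m \<Longrightarrow> r \<ge> 0 \<Longrightarrow> z * of_real r \<in> wedge m"
  using mult_left_mono[of "\<bar>Im z\<bar>" "m * Re z" r] by (simp add: wedge_def abs_mult mult_ac)

lemma of_real_in_wedge: "m \<ge> 0 \<Longrightarrow> t \<ge> 0 \<Longrightarrow> of_real t \<in> wedge m"
  by (simp add: wedge_def)

lemma wedge_Re_pos: "z \<in> wedge m \<Longrightarrow> z \<noteq> 0 \<Longrightarrow> Re z > 0"
  by (cases "Re z = 0") (auto simp: wedge_def complex_eq_iff)

text \<open>For \<open>m = tan \<phi>\<close> the constant is \<open>cos (2 \<phi>)\<close>; it is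
  positive exactly when \<open>m < 1\<close>, that is for half-angles below
  \<open>pi/4\<close>.\<close>

lemma wedge_Re_square:
  assumes "z \<in> wedge m" "0 \<le> m"
  shows "Re (z\<^sup>2) \<ge> (1 - m\<^sup>2) / (1 + m\<^sup>2) * (norm z)\<^sup>2"
proof -
  have "(Im z)\<^sup>2 \<le> m\<^sup>2 * (Re z)\<^sup>2"
    using power_mono[of "\<bar>Im z\<bar>" "m * Re z" 2] assms by (simp add: wedge_def power_mult_distrib)
  hence "(1 - m\<^sup>2) * ((Re z)\<^sup>2 + (Im z)\<^sup>2) \<le> ((Re z)\<^sup>2 - (Im z)\<^sup>2) * (1 + m\<^sup>2)"
    by (simp add: algebra_simps)
  moreover have "1 + m\<^sup>2 > 0" by (simp add: add_pos_nonneg)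
  ultimately show ?thesis
    by (simp add: cmod_power2 power2_eq_square[of z] field_simps) (simp add: power2_eq_square field_simps)
qed

text \<open>Crude but sufficient: growth that is exponential in \<open>norm z\<close> is absorbed by
  any Gaussian. The summand \<open>pi\<close> bounds the argument, which enters for nonreal
  \<open>w\<close>.\<close>

lemma norm_powr_complex_le:
  fixes z w :: complex
  assumes "norm z \<ge> 1"
  shows "norm (z powr w) \<le> exp (norm w * (norm z + pi))"
proof -
  have z: "z \<noteq> 0" using assms by auto
  have "norm (Ln z) \<le> \<bar>Re (Ln z)\<bar> + \<bar>Im (Ln z)\<bar>" by (rule cmod_le)
  also have "\<bar>Re (Ln z)\<bar> \<le> norm z"
    using z assms ln_le_minus_one[of "norm z"] by simp
  also have "\<bar>Im (Ln z)\<bar> \<le> pi" using mpi_less_Im_Ln[OF z] Im_Ln_le_pi[OF z] by simp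
  finally have "norm (Ln z) \<le> norm z + pi" by simp
  hence "norm (w * Ln z) \<le> norm w * (norm z + pi)" by (simp add: norm_mult mult_left_mono)
  hence "Re (w * Ln z) \<le> norm w * (norm z + pi)" using complex_Re_le_cmod order_trans by blast
  thus ?thesis using z by (simp add: powr_def)
qed

text \<open>Far out, the asymptotic form of \<open>U\<close> applies, and the modulus of
  \<open>exp (- z^2 / 4)\<close> is Gaussian because \<open>Re (z^2)\<close> dominates
  \<open>norm z\<close> squared. On the remaining disc \<open>U\<close> is bounded by
  compactness.\<close>

lemma pcfU_wedge_bound:
  assumes U: "is_pcfU a U" and m: "0 \<le> m" "m < 1"
  shows "\<exists>B c. B \<ge> 0 \<and> c > 0 \<and> (\<forall>z\<in>wedge m. norm (U z) \<le> B * exp (- c * (norm z)\<^sup>2))"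
proof -
  define w where "w = - a - 1/2"
  define \<kappa> where "\<kappa> = (1 - m\<^sup>2) / (1 + m\<^sup>2)"
  have \<kappa>: "\<kappa> > 0" unfolding \<kappa>_def using m by (intro divide_pos_pos) (auto simp: power_less_one_iff abs_square_less_1 add_pos_nonneg)
  have "((\<lambda>z. norm (U z / (z powr w * exp (- z\<^sup>2 / 4)))) \<longlongrightarrow> norm (1 :: complex))
     (inf at_infinity (principal (pc_sector (pi / 4))))"
    using U unfolding is_pcfU_def w_def by (intro tendsto_norm) auto
  hence "\<forall>\<^sub>F z in inf at_infinity (principal (pc_sector (pi / 4))). norm (U z / (z powr w * exp (- z\<^sup>2 / 4))) < 2"
    by (rule order_tendstoD) simp
  then obtain R0 where R0: "\<And>z. norm z \<ge> R0 \<Longrightarrow> z \<in> pc_sector (pi/4) \<Longrightarrow> norm (U z / (z powr w * exp (- z\<^sup>2 / 4))) < 2"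
    by (auto simp: eventually_inf_principal eventually_at_infinity)
  define R where "R = max R0 1"
  \<comment> \<open>The 2 bounds the ratio of \<open>U\<close> to its asymptotic form. The exponent
    comes from completing the square: half of the available rate \<open>\<kappa> / 4\<close> absorbs
    the linear term \<open>norm w * norm z\<close> of the power.\<close>
  define B1 where "B1 = 2 * exp (norm w * pi + 2 * (norm w)\<^sup>2 / \<kappa>)"
  have large: "norm (U z) \<le> B1 * exp (- (\<kappa> / 8) * (norm z)\<^sup>2)" if z: "z \<in> wedge m" "norm z \<ge> R" for z
  proof -
    have z0: "z \<noteq> 0" "norm z \<ge> 1" using z by (auto simp: R_def)
    \<comment> \<open>\<open>pi / 2\<close> is \<open>3 * pi / 4 - pi / 4\<close>, which explains
      the choice \<open>\<delta> = pi / 4\<close>.\<close>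
    have "\<bar>Arg z\<bar> < pi / 2" using wedge_Re_pos[OF z(1) z0(1)] Arg_Re_pos by blast
    hence "z \<in> pc_sector (pi / 4)" using z0 by (simp add: pc_sector_def)
    hence "norm (U z / (z powr w * exp (- z\<^sup>2 / 4))) < 2" using z by (intro R0) (auto simp: R_def)
    hence "norm (U z) \<le> 2 * (norm (z powr w) * norm (exp (- z\<^sup>2 / 4)))"
      using z0 by (simp add: norm_divide norm_mult field_simps)
    also have "norm (exp (- z\<^sup>2 / 4)) \<le> exp (- (\<kappa> / 4) * (norm z)\<^sup>2)"
      using wedge_Re_square[OF z(1) m(1)] by (simp flip: \<kappa>_def)
    also have "norm (z powr w) \<le> exp (norm w * (norm z + pi))" using z0 by (intro norm_powr_complex_le) auto
    also have "exp (norm w * (norm z + pi)) * exp (- (\<kappa> / 4) * (norm z)\<^sup>2)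
       \<le> exp (norm w * pi + 2 * (norm w)\<^sup>2 / \<kappa>) * exp (- (\<kappa> / 8) * (norm z)\<^sup>2)"
    proof -
      have "0 \<le> (\<kappa> * norm z / 4 - norm w)\<^sup>2 * 2 / \<kappa>" using \<kappa> by simp
      also have "\<dots> = (\<kappa> / 8) * (norm z)\<^sup>2 - norm w * norm z + 2 * (norm w)\<^sup>2 / \<kappa>"
        using \<kappa> by (simp add: power2_eq_square field_simps)
      finally show ?thesis by (simp add: algebra_simps flip: exp_add)
    qed
    finally show ?thesis by (simp add: B1_def mult_left_mono mult_right_mono)
  qed
  have "compact (U ` cball 0 R)"
    using U unfolding is_pcfU_def
    by (intro compact_continuous_image) (auto intro: holomorphic_on_imp_continuous_on continuous_on_subset)
  then obtain B0 where B0: "\<And>z. norm z \<le> R \<Longrightarrow> norm (U z) \<le> B0"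
    using compact_imp_bounded by (fastforce simp: bounded_iff)
  \<comment> \<open>The factor \<open>exp (\<kappa> / 8 * R\<^sup>2)\<close> compensates for the
    Gaussian on the disc of radius \<open>R\<close>.\<close>
  define B where "B = max B1 (B0 * exp (\<kappa> / 8 * R\<^sup>2))"
  show ?thesis
  proof (intro exI conjI ballI)
    fix z assume z: "z \<in> wedge m"
    show "norm (U z) \<le> B * exp (- (\<kappa> / 8) * (norm z)\<^sup>2)"
    proof (cases "norm z \<ge> R")
      case True
      from large[OF z this] show ?thesis
        by (rule order_trans) (auto simp: B_def)
    next
      case False
      have B0': "B0 \<ge> 0" using B0[of z] False norm_ge_zero[of "U z"] by linarith
      have "norm (U z) \<le> B0" using False by (intro B0) auto
      also have "\<dots> \<le> B0 * (exp (\<kappa> / 8 * R\<^sup>2) * exp (- (\<kappa> / 8) * (norm z)\<^sup>2))"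
      proof -
        have "(norm z)\<^sup>2 \<le> R\<^sup>2" using False by (intro power_mono) auto
        hence "exp (\<kappa> / 8 * R\<^sup>2) * exp (- (\<kappa> / 8) * (norm z)\<^sup>2) \<ge> 1"
          using \<kappa> by (simp flip: exp_add)
        thus ?thesis using B0' mult_left_mono[of 1 _ B0] by simp
      qed
      also have "\<dots> \<le> B * exp (- (\<kappa> / 8) * (norm z)\<^sup>2)"
        by (simp add: B_def mult.assoc[symmetric])
      finally show ?thesis .
    qed
  qed (use \<kappa> in \<open>auto simp: B_def B1_def le_max_iff_disj\<close>)
qed

section \<open>The values at the origin\<close>

lemma absolutely_integrable_power_gaussian:
  assumes "continuous_on {0..} f" and "\<And>t. t \<ge> 0 \<Longrightarrow> norm (f t) \<le> B * exp (- t\<^sup>2 / 4)"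
  shows "(\<lambda>t. of_real t ^ k * f t :: complex) absolutely_integrable_on {0..}"
proof -
  obtain B' where B': "\<And>t::real. t \<ge> 0 \<Longrightarrow> t ^ k * exp (- (1/2) * t) \<le> B'"
    using power_times_exp_bounded[of "1/2" k] by auto
  have "0 \<le> norm (f 0)" "norm (f 0) \<le> B" using assms(2)[of 0] by auto
  hence B: "B \<ge> 0" by linarith
  show ?thesis
  proof (rule absolutely_integrable_exp_bound)
    fix t :: real assume t: "t \<ge> 0"
    have "exp (- t\<^sup>2 / 4) \<le> exp (1 - t)"
    proof -
      have "0 \<le> (t / 2 - 1)\<^sup>2" by simp
      thus ?thesis by (simp add: power2_eq_square algebra_simps)
    qed
    hence "norm (f t) \<le> B * exp (1 - t)"
      using assms(2)[OF t] B mult_left_mono[of _ _ B] by (meson order_trans)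
    hence "norm (of_real t ^ k * f t) \<le> t ^ k * (B * exp (1 - t))"
      using t by (simp add: norm_mult norm_power mult_left_mono)
    also have "\<dots> = (B * exp 1 * exp (- (1/2) * t)) * (t ^ k * exp (- (1/2) * t))"
      by (simp add: exp_diff exp_minus field_simps flip: exp_add)
    also have "\<dots> \<le> (B * exp 1 * exp (- (1/2) * t)) * B'"
      using B B'[OF t] by (intro mult_left_mono) auto
    finally show "norm (of_real t ^ k * f t) \<le> (B * exp 1 * B') * exp (- (1/2) * t)" by (simp add: mult_ac)
  qed (use assms in \<open>auto intro!: continuous_intros\<close>)
qed

text \<open>The weight \<open>exp (- t^2 / 4)\<close> removes the quadratic coefficient from the
  differential equation, which leaves a recurrence between only two moments.\<close>

definition pcfU_moment :: "(complex \<Rightarrow> complex) \<Rightarrow> nat \<Rightarrow> complex" where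
  "pcfU_moment U k = integral {0..} (\<lambda>t::real. of_real t ^ k * (exp (- (of_real t)\<^sup>2 / 4) * U (of_real t)))"

lemma pcfU_moment_integrable:
  assumes U: "is_pcfU a U"
  shows "(\<lambda>t::real. of_real t ^ k * (exp (- (of_real t)\<^sup>2 / 4) * U (of_real t))) absolutely_integrable_on {0..}"
proof -
  obtain B c where B: "B \<ge> 0" "c > 0" "\<And>z. z \<in> wedge 0 \<Longrightarrow> norm (U z) \<le> B * exp (- c * (norm z)\<^sup>2)"
    using pcfU_wedge_bound[OF U, of 0] by auto
  have cont: "continuous_on UNIV U" using U by (auto simp: is_pcfU_def intro: holomorphic_on_imp_continuous_on)
  show ?thesis
  proof (rule absolutely_integrable_power_gaussian)
    have "continuous_on {0..} (\<lambda>t::real. U (of_real t))"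
      by (rule continuous_on_compose2[OF cont]) (auto intro!: continuous_intros)
    thus "continuous_on {0..} (\<lambda>t::real. exp (- (of_real t)\<^sup>2 / 4) * U (of_real t))"
      by (intro continuous_intros) auto
    fix t :: real assume t: "t \<ge> 0"
    have "norm (U (of_real t)) \<le> B * exp (- c * (norm (of_real t :: complex))\<^sup>2)"
      using t by (intro B(3) of_real_in_wedge) auto
    also have "\<dots> \<le> B * 1" using B by (intro mult_left_mono) auto
    finally show "norm (exp (- (of_real t)\<^sup>2 / 4) * U (of_real t)) \<le> B * exp (- t\<^sup>2 / 4)"
      by (simp add: norm_mult mult.commute mult_left_mono flip: of_real_power)
  qed
qed

text \<open>Cauchy's estimate on unit circles bounds the derivative. For \<open>t \<ge> 3\<close>
  such a circle has \<open>Re \<ge> 2\<close> and \<open>\<bar>Im\<bar> \<le> 1\<close>, so it stays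
  in \<open>wedge (1/2)\<close>.\<close>

lemma pcfU_bounded_on_reals:
  assumes U: "is_pcfU a U"
  shows "\<exists>B. \<forall>t\<ge>3. norm (U (of_real t)) \<le> B \<and> norm (deriv U (of_real t)) \<le> B"
proof -
  obtain B c where B: "B \<ge> 0" "c > 0" "\<And>z. z \<in> wedge (1/2) \<Longrightarrow> norm (U z) \<le> B * exp (- c * (norm z)\<^sup>2)"
    using pcfU_wedge_bound[OF U, of "1/2"] by auto
  have bd: "norm (U z) \<le> B" if "z \<in> wedge (1/2)" for z
  proof -
    have "B * exp (- c * (norm z)\<^sup>2) \<le> B * 1" using B by (intro mult_left_mono) auto
    with B(3)[OF that] show ?thesis by linarith
  qed
  have hol: "U holomorphic_on UNIV" using U by (simp add: is_pcfU_def)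
  have "norm (deriv U (of_real t)) \<le> B" if t: "t \<ge> 3" for t :: real
  proof -
    have "norm ((deriv ^^ 1) U (of_real t)) \<le> fact 1 * B / 1 ^ 1"
    proof (rule Cauchy_inequality)
      fix x :: complex assume x: "norm (of_real t - x) = 1"
      have "\<bar>Re (of_real t - x)\<bar> \<le> 1" "\<bar>Im (of_real t - x)\<bar> \<le> 1"
        using abs_Re_le_cmod[of "of_real t - x"] abs_Im_le_cmod[of "of_real t - x"] x by auto
      thus "norm (U x) \<le> B" using t by (intro bd) (auto simp: wedge_def)
    qed (use hol in \<open>auto intro: holomorphic_on_subset holomorphic_on_imp_continuous_on continuous_on_subset\<close>)
    thus ?thesis by simp
  qed
  moreover have "norm (U (of_real t)) \<le> B" if "t \<ge> 3" for t :: real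
    using that by (intro bd of_real_in_wedge) auto
  ultimately show ?thesis by blast
qed

text \<open>One formula for all \<open>k\<close>: the terms with powers of 0 are the boundary values
  at the origin, present only for \<open>k = 1\<close> and \<open>k = 0\<close>. The truncated
  \<open>k - 1\<close> and \<open>k - 2\<close> are harmless because their coefficients vanish for
  small \<open>k\<close>.\<close>

lemma pcfU_moment_rec:
  assumes U: "is_pcfU a U"
  shows "(a + 1/2 + of_nat k) * pcfU_moment U k
    = of_nat k * of_nat (k - 1) * pcfU_moment U (k - 2) + of_nat k * 0 ^ (k - 1) * U 0 - 0 ^ k * deriv U 0"
proof -
  have hol: "U holomorphic_on UNIV" and ode: "\<And>z. deriv (deriv U) z = (z\<^sup>2 / 4 + a) * U z"
    using U by (auto simp: is_pcfU_def)
  have dU: "(U has_field_derivative deriv U z) (at z)" for z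
    by (rule holomorphic_derivI[OF hol]) auto
  have dV: "(deriv U has_field_derivative (z\<^sup>2 / 4 + a) * U z) (at z)" for z
    unfolding ode[symmetric] by (rule holomorphic_derivI[OF holomorphic_deriv[OF hol]]) auto
  define e where "e = (\<lambda>z::complex. exp (- z\<^sup>2 / 4))"
  have de: "(e has_field_derivative - z / 2 * e z) (at z)" for z
    unfolding e_def by (auto intro!: derivative_eq_intros)
  define p where "p = (\<lambda>z::complex. z ^ k)"
  define p1 where "p1 = (\<lambda>z::complex. of_nat k * z ^ (k - 1))"
  define p2 where "p2 = (\<lambda>z::complex. of_nat k * of_nat (k - 1) * z ^ (k - 2))"
  have dp: "(p has_field_derivative p1 z) (at z)" for z
    unfolding p_def p1_def by (rule derivative_eq_intros refl)+ simp
  have dp1: "(p1 has_field_derivative p2 z) (at z)" for z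
    unfolding p1_def p2_def by (rule derivative_eq_intros refl)+ (simp add: numeral_2_eq_2)
  have zp1: "z * p1 z = of_nat k * p z" for z by (cases k) (auto simp: p1_def p_def)
  \<comment> \<open>With \<open>g = e * U\<close> this is \<open>p g' + (z p - p') g\<close>, the
    result of integrating \<open>p (g'' + z g')\<close> by parts.\<close>
  define F where "F = (\<lambda>z. e z * (p z * deriv U z + (z * p z / 2 - p1 z) * U z))"
  have dF: "(F has_field_derivative e z * U z * ((a + 1/2 + of_nat k) * p z - p2 z)) (at z)" for z
  proof -
    have "(F has_field_derivative
        - z / 2 * e z * (p z * deriv U z + (z * p z / 2 - p1 z) * U z) +
        e z * (p1 z * deriv U z + p z * ((z\<^sup>2 / 4 + a) * U z) + ((p z + z * p1 z) / 2 - p2 z) * U z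
          + (z * p z / 2 - p1 z) * deriv U z)) (at z)"
      unfolding F_def
      by (auto intro!: derivative_eq_intros de dp dp1 dU dV simp: field_simps power2_eq_square)
    also have "- z / 2 * e z * (p z * deriv U z + (z * p z / 2 - p1 z) * U z) +
        e z * (p1 z * deriv U z + p z * ((z\<^sup>2 / 4 + a) * U z) + ((p z + z * p1 z) / 2 - p2 z) * U z
          + (z * p z / 2 - p1 z) * deriv U z)
        = e z * U z * ((a + 1/2) * p z + z * p1 z - p2 z)"
      by (simp add: field_simps power2_eq_square)
    also have "\<dots> = e z * U z * ((a + 1/2 + of_nat k) * p z - p2 z)"
      unfolding zp1 by (simp add: algebra_simps)
    finally show ?thesis .
  qed
  let ?h = "\<lambda>k (t::real). of_real t ^ k * (exp (- (of_real t)\<^sup>2 / 4) * U (of_real t))"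
  note ai = pcfU_moment_integrable[OF U]
  have "integral {0..} (\<lambda>t. (a + 1/2 + of_nat k) * ?h k t - of_nat k * of_nat (k - 1) * ?h (k - 2) t) = 0 - F (of_real 0)"
  proof (rule FTC_integral_at_top)
    show "((\<lambda>t. F (of_real t)) has_vector_derivative
       ((a + 1/2 + of_nat k) * ?h k t - of_nat k * of_nat (k - 1) * ?h (k - 2) t)) (at t)" for t :: real
      by (rule has_vector_derivative_real_field) (use dF[of "of_real t"] in \<open>simp add: e_def p_def p2_def algebra_simps\<close>)
    show "(\<lambda>t. (a + 1/2 + of_nat k) * ?h k t - of_nat k * of_nat (k - 1) * ?h (k - 2) t) absolutely_integrable_on {0..}"
      by (intro set_integral_diff set_integrable_mult_right ai)
    obtain B where B: "\<And>t. t \<ge> 3 \<Longrightarrow> norm (U (of_real t)) \<le> B \<and> norm (deriv U (of_real t)) \<le> B"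
      using pcfU_bounded_on_reals[OF U] by auto
    show "((\<lambda>t. F (of_real t)) \<longlongrightarrow> 0) at_top"
    proof (rule Lim_null_comparison)
      \<comment> \<open>\<open>U\<close> and its derivative are merely bounded on the axis; the
        factor \<open>exp (- t\<^sup>2 / 4)\<close> gives the decay.\<close>
      show "\<forall>\<^sub>F t in at_top. norm (F (of_real t)) \<le> exp (- t\<^sup>2 / 4) * (t ^ k + (t * t ^ k / 2 + real k * t ^ (k - 1))) * B"
        using eventually_ge_at_top[of 3]
      proof eventually_elim
        case (elim t)
        have "norm (F (of_real t)) \<le> norm (e (of_real t)) * (norm (p (of_real t)) * norm (deriv U (of_real t))
            + norm (of_real t * p (of_real t) / 2 - p1 (of_real t)) * norm (U (of_real t)))"
          unfolding F_def norm_mult[of "e _"] by (intro mult_left_mono norm_triangle_le) (auto simp: norm_mult)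
        also have "\<dots> \<le> norm (e (of_real t)) * (norm (p (of_real t)) * B
            + (norm (of_real t * p (of_real t) / 2) + norm (p1 (of_real t))) * B)"
          using B[OF elim] by (intro mult_left_mono add_mono mult_mono norm_triangle_ineq4) auto
        also have "\<dots> = exp (- t\<^sup>2 / 4) * (t ^ k + (t * t ^ k / 2 + real k * t ^ (k - 1))) * B"
          using elim by (simp add: e_def p_def p1_def norm_mult norm_divide norm_power algebra_simps flip: of_real_power)
        finally show ?case .
      qed
      have lim: "((\<lambda>t::real. t ^ j * exp (- t\<^sup>2 / 4)) \<longlongrightarrow> 0) at_top" for j :: nat by real_asymp
      have "((\<lambda>t. (t ^ k * exp (- t\<^sup>2 / 4) + (1/2 * (t ^ Suc k * exp (- t\<^sup>2 / 4)) + real k * (t ^ (k - 1) * exp (- t\<^sup>2 / 4)))) * B) \<longlongrightarrow> (0 + (1/2 * 0 + real k * 0)) * B) at_top"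
        by (intro tendsto_intros lim)
      thus "((\<lambda>t. exp (- t\<^sup>2 / 4) * (t ^ k + (t * t ^ k / 2 + real k * t ^ (k - 1))) * B) \<longlongrightarrow> 0) at_top"
        by (simp add: algebra_simps)
    qed
  qed
  also have "integral {0..} (\<lambda>t. (a + 1/2 + of_nat k) * ?h k t - of_nat k * of_nat (k - 1) * ?h (k - 2) t)
     = (a + 1/2 + of_nat k) * pcfU_moment U k - of_nat k * of_nat (k - 1) * pcfU_moment U (k - 2)"
    using ai[of k] ai[of "k - 2"] unfolding pcfU_moment_def
    by (subst integral_diff) (simp_all only: integral_mult_right set_lebesgue_integral_eq_integral(1) set_integrable_mult_right)
  finally show ?thesis by (simp add: F_def e_def p_def p1_def algebra_simps)
qed

text \<open>Iterates the recurrence upwards from order \<open>i\<close>; the coefficient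
  \<open>a + 1/2 + i\<close> on the left is the first of the \<open>n + 1\<close> Pochhammer
  factors. Only \<open>k (k - 1)\<close> is ever divided by, so no value of \<open>a\<close> is
  exceptional.\<close>

lemma pcfU_moment_unroll:
  assumes U: "is_pcfU a U"
  defines "q i \<equiv> (a + 1/2 + of_nat i) / 2"
  shows "(a + 1/2 + of_nat i) * pcfU_moment U i
    = 2 ^ (n + 1) * pochhammer (q i) (n + 1) * fact i / fact (2 * n + i) * pcfU_moment U (2 * n + i)"
proof (induction n)
  case 0
  show ?case by (simp add: q_def)
next
  case (Suc n)
  define k where "k = 2 * n + i + 2"
  have "(a + 1/2 + of_nat k) * pcfU_moment U k = of_nat k * of_nat (k - 1) * pcfU_moment U (2 * n + i)"
    using pcfU_moment_rec[OF U, of k] by (simp add: k_def power_0_left)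
  moreover have "a + 1/2 + of_nat k = 2 * (q i + of_nat (n + 1))"
    by (simp add: q_def k_def field_simps)
  moreover have nz: "of_nat k * of_nat (k - 1) \<noteq> (0 :: complex)"
    unfolding of_nat_mult[symmetric] of_nat_eq_0_iff by (simp add: k_def)
  ultimately have m: "pcfU_moment U (2 * n + i) = 2 * (q i + of_nat (n + 1)) * pcfU_moment U k / (of_nat k * of_nat (k - 1))"
    by (simp only: nonzero_eq_divide_eq) (simp add: mult.commute)
  have f: "fact k = (of_nat k * of_nat (k - 1) * fact (2 * n + i) :: complex)"
    by (simp add: k_def algebra_simps)
  have k: "2 * Suc n + i = k" by (simp add: k_def)
  have "pochhammer (q i) (Suc n + 1) = pochhammer (q i) (n + 1) * (q i + of_nat (n + 1))"
    by (simp only: add_Suc pochhammer_Suc)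
  thus ?case unfolding Suc.IH m k f using nz by (simp add: mult_ac)
qed

text \<open>On the positive axis \<open>G\<close> is asymptotic to \<open>e b\<close>, so their
  difference is small relative to \<open>w\<close>, the modulus of \<open>e b\<close>. Its large
  moments are then negligible against those of \<open>w\<close>, which have the size of
  \<open>moment_scale\<close>.\<close>

lemma pcfU_moment_asymp:
  assumes U: "is_pcfU a U"
  shows "(\<lambda>n. pcfU_moment U (2 * n + i) / moment_scale a i n) \<longlonglongrightarrow> 1"
proof -
  define b where "b = - a - 1/2"
  \<comment> \<open>From this order on, the power of \<open>t\<close> compensates for the
    singularity of \<open>t powr b\<close> at 0.\<close>
  define n0 where "n0 = nat \<lceil>\<bar>Re a\<bar>\<rceil> + 1"
  define G where "G = (\<lambda>t::real. exp (- (of_real t)\<^sup>2 / 4) * U (of_real t))"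
  define e where "e = (\<lambda>b (t::real). of_real t powr b * exp (- (of_real t)\<^sup>2 / 2) :: complex)"
  define d where "d = (\<lambda>t. G t - e b t)"
  define w where "w = (\<lambda>t::real. t powr Re b * exp (- t\<^sup>2 / 2))"
  define J where "J = (\<lambda>b n. integral {0..} (\<lambda>t. of_real t ^ n * e b t))"
  have n0: "n \<ge> 1" "real n + Re b > -1" "real n + Re (of_real (Re b)) > -1" if "n \<ge> n0" for n
    using that unfolding n0_def b_def by (auto, linarith+)
  have e: "(\<lambda>t. of_real t ^ n * e b t) absolutely_integrable_on {0..}" if "n \<ge> n0" for n
    unfolding e_def using n0[OF that] by (intro powr_gaussian_moment) auto
  \<comment> \<open>The positive weight is the case of the real exponent \<open>Re b\<close>, so the
    asymptotics of its moments are already known.\<close>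
  have ew: "of_real t ^ n * e (of_real (Re b)) t = of_real (t ^ n * w t)" if "t \<ge> 0" for t n
    using that by (simp add: e_def w_def powr_of_real of_real_exp)
  have w: "((\<lambda>t. t ^ n * w t) has_integral Re (J (of_real (Re b)) n)) {0..}" "J (of_real (Re b)) n = of_real (integral {0..} (\<lambda>t. t ^ n * w t))"
    if "n \<ge> n0" for n
  proof -
    have "(\<lambda>t. of_real t ^ n * e (of_real (Re b)) t) absolutely_integrable_on {0..}"
      unfolding e_def using n0[OF that] by (intro powr_gaussian_moment) auto
    hence h: "((\<lambda>t. of_real t ^ n * e (of_real (Re b)) t) has_integral J (of_real (Re b)) n) {0..}"
      by (simp add: J_def has_integral_iff set_lebesgue_integral_eq_integral(1))
    have "((\<lambda>t. Re (of_real t ^ n * e (of_real (Re b)) t)) has_integral Re (J (of_real (Re b)) n)) {0..}"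
      using has_integral_linear[OF h bounded_linear_Re] by (simp only: o_def)
    thus 1: "((\<lambda>t. t ^ n * w t) has_integral Re (J (of_real (Re b)) n)) {0..}"
      by (rule has_integral_eq[rotated]) (simp only: ew atLeast_iff Re_complex_of_real)
    have "((\<lambda>t. complex_of_real (t ^ n * w t)) has_integral of_real (integral {0..} (\<lambda>t. t ^ n * w t))) {0..}"
      using has_integral_linear[OF 1, of complex_of_real] integral_unique[OF 1]
      by (simp only: o_def bounded_linear_of_real)
    hence "((\<lambda>t. of_real t ^ n * e (of_real (Re b)) t) has_integral of_real (integral {0..} (\<lambda>t. t ^ n * w t))) {0..}"
      by (rule has_integral_eq[rotated]) (simp only: ew atLeast_iff)
    thus "J (of_real (Re b)) n = of_real (integral {0..} (\<lambda>t. t ^ n * w t))"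
      using h has_integral_unique by blast
  qed
  have G: "(\<lambda>t. of_real t ^ n * G t) absolutely_integrable_on {0..}" for n
    unfolding G_def by (rule pcfU_moment_integrable[OF U])
  have "((\<lambda>z. U z / (z powr b * exp (- z\<^sup>2 / 4))) \<longlongrightarrow> 1) (inf at_infinity (principal (pc_sector (pi / 4))))"
    using U by (simp add: is_pcfU_def b_def)
  moreover have "filterlim complex_of_real (inf at_infinity (principal (pc_sector (pi / 4)))) at_top"
  proof (rule filterlim_inf[THEN iffD2, OF conjI])
    show "filterlim complex_of_real at_infinity at_top"
      by (intro filterlim_norm_at_top_imp_at_infinity) (simp add: filterlim_abs_real)
    have "of_real t \<in> pc_sector (pi / 4)" if "t > 0" for t :: real
      using that by (simp add: pc_sector_def Arg_of_real)
    thus "filterlim complex_of_real (principal (pc_sector (pi / 4))) at_top"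
      by (auto simp: filterlim_principal intro: eventually_mono[OF eventually_gt_at_top[of 0]])
  qed
  ultimately have "((\<lambda>t::real. U (of_real t) / (of_real t powr b * exp (- (of_real t)\<^sup>2 / 4))) \<longlongrightarrow> 1) at_top"
    by (rule filterlim_compose)
  hence "((\<lambda>t::real. norm (U (of_real t) / (of_real t powr b * exp (- (of_real t)\<^sup>2 / 4)) - 1)) \<longlongrightarrow> 0) at_top"
    by (simp only: tendsto_norm_zero_iff LIM_zero_iff)
  moreover have "\<forall>\<^sub>F t in at_top. norm (U (of_real t) / (of_real t powr b * exp (- (of_real t)\<^sup>2 / 4)) - 1) = norm (d t) / w t"
    using eventually_gt_at_top[of 0]
  proof eventually_elim
    case (elim t)
    have half: "exp (- (of_real t)\<^sup>2 / 2) = exp (- (of_real t)\<^sup>2 / 4) * exp (- (complex_of_real t)\<^sup>2 / 4)"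
      by (simp flip: exp_add)
    have "norm (e b t) = w t"
      using elim by (simp add: e_def w_def norm_mult norm_powr_real_powr flip: of_real_power)
    moreover have "U (of_real t) / (of_real t powr b * exp (- (of_real t)\<^sup>2 / 4)) - 1 = d t / e b t"
    proof -
      have "u / (p * x) - 1 = (x * u - p * (x * x)) / (p * (x * x))" if "p \<noteq> 0" "x \<noteq> 0" for u p x :: complex
        using that by (simp add: diff_divide_distrib)
      thus ?thesis unfolding d_def G_def e_def half using elim by simp
    qed
    ultimately show ?case by (simp add: norm_divide)
  qed
  ultimately have lim: "((\<lambda>t. norm (d t) / w t) \<longlongrightarrow> 0) at_top" by (rule Lim_transform_eventually)
  have "(\<lambda>n. norm (integral {0..} (\<lambda>t. of_real t ^ n * d t)) / integral {0..} (\<lambda>t. t ^ n * w t)) \<longlonglongrightarrow> 0"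
  proof (rule moment_ratio_tendsto_0[where m = n0])
    show "continuous_on {0<..} w" unfolding w_def by (auto intro!: continuous_intros)
    show "(\<lambda>t. of_real t ^ n * d t) absolutely_integrable_on {0..}" if "n \<ge> n0" for n
      unfolding d_def right_diff_distrib by (intro set_integral_diff G e that)
    show "(\<lambda>t. t ^ n * w t) integrable_on {0..}" if "n \<ge> n0" for n
      using w(1)[OF that] by blast
  qed (use lim in \<open>auto simp: w_def\<close>)
  hence "(\<lambda>n. norm (integral {0..} (\<lambda>t. of_real t ^ (2 * n + i) * d t)) / integral {0..} (\<lambda>t. t ^ (2 * n + i) * w t)) \<longlonglongrightarrow> 0"
    by (rule filterlim_compose) (auto intro!: filterlim_subseq simp: strict_mono_def)
  moreover have "(\<lambda>n. norm (J (of_real (Re b)) (2 * n + i) / moment_scale (of_real (Re a)) i n)) \<longlonglongrightarrow> norm (1 :: complex)"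
    using tendsto_norm[OF powr_gaussian_moment_asymp[of i "of_real (Re a)"]]
    by (simp add: J_def e_def b_def)
  ultimately have "(\<lambda>n. norm (integral {0..} (\<lambda>t. of_real t ^ (2 * n + i) * d t)) / integral {0..} (\<lambda>t. t ^ (2 * n + i) * w t)
     * norm (J (of_real (Re b)) (2 * n + i) / moment_scale (of_real (Re a)) i n)) \<longlonglongrightarrow> 0 * norm (1 :: complex)"
    by (rule tendsto_mult)
  hence "(\<lambda>n. norm (integral {0..} (\<lambda>t. of_real t ^ (2 * n + i) * d t)) / integral {0..} (\<lambda>t. t ^ (2 * n + i) * w t)
     * norm (J (of_real (Re b)) (2 * n + i) / moment_scale (of_real (Re a)) i n)) \<longlonglongrightarrow> 0"
    by simp
  moreover have "\<forall>\<^sub>F n in sequentially. norm (integral {0..} (\<lambda>t. of_real t ^ (2 * n + i) * d t)) / integral {0..} (\<lambda>t. t ^ (2 * n + i) * w t)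
     * norm (J (of_real (Re b)) (2 * n + i) / moment_scale (of_real (Re a)) i n)
     = norm (pcfU_moment U (2 * n + i) / moment_scale a i n - J b (2 * n + i) / moment_scale a i n)"
  proof -
    \<comment> \<open>The ratio tends to 1, so the moment of \<open>w\<close> is eventually nonzero
      and may be cancelled.\<close>
    have "\<forall>\<^sub>F n in sequentially. J (of_real (Re b)) (2 * n + i) / moment_scale (of_real (Re a)) i n \<noteq> 0"
      using tendsto_imp_eventually_ne[OF powr_gaussian_moment_asymp[of i "of_real (Re a)"], of 0]
      by (simp add: J_def e_def b_def)
    thus ?thesis using eventually_ge_at_top[of n0]
    proof eventually_elim
      case (elim n)
      have n: "2 * n + i \<ge> n0" using elim by simp
      define W where "W = integral {0..} (\<lambda>t. t ^ (2 * n + i) * w t)"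
      have "W \<ge> 0" unfolding W_def using w(1)[OF n]
        by (intro integral_nonneg) (auto simp: w_def)
      moreover have JW: "J (of_real (Re b)) (2 * n + i) = of_real W" using w(2)[OF n] by (simp add: W_def)
      moreover have "W \<noteq> 0" using elim(1) JW by auto
      ultimately have W: "W > 0" by simp
      have "integral {0..} (\<lambda>t. of_real t ^ (2 * n + i) * d t) = pcfU_moment U (2 * n + i) - J b (2 * n + i)"
        using G[of "2 * n + i"] e[OF n] unfolding d_def right_diff_distrib pcfU_moment_def J_def
        by (subst integral_diff) (simp_all add: set_lebesgue_integral_eq_integral(1) G_def)
      moreover have "norm (moment_scale (of_real (Re a)) i n) = norm (moment_scale a i n)"
        using elim(2) by (intro norm_moment_scale) (simp add: n0_def)
      ultimately show ?case
        using W by (simp add: JW norm_divide flip: W_def diff_divide_distrib)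
    qed
  qed
  ultimately have "(\<lambda>n. norm (pcfU_moment U (2 * n + i) / moment_scale a i n - J b (2 * n + i) / moment_scale a i n)) \<longlonglongrightarrow> 0"
    by (rule Lim_transform_eventually)
  hence "(\<lambda>n. pcfU_moment U (2 * n + i) / moment_scale a i n - J b (2 * n + i) / moment_scale a i n) \<longlonglongrightarrow> 0"
    by (rule tendsto_norm_zero_cancel)
  moreover have "(\<lambda>n. J b (2 * n + i) / moment_scale a i n) \<longlonglongrightarrow> 1"
    using powr_gaussian_moment_asymp[of i a] by (simp add: J_def e_def b_def)
  ultimately have "(\<lambda>n. pcfU_moment U (2 * n + i) / moment_scale a i n - J b (2 * n + i) / moment_scale a i n
      + J b (2 * n + i) / moment_scale a i n) \<longlonglongrightarrow> 0 + 1"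
    by (rule tendsto_add)
  thus ?thesis by simp
qed

text \<open>Wallis' limit for \<open>i = 0\<close>; for \<open>i = 1\<close> the additional factor
  \<open>n / (2 n + 1)\<close> tends to 1/2.\<close>

lemma fact_double_asymp:
  assumes "i \<le> 1"
  shows "(\<lambda>n. 4 ^ n * (fact n)\<^sup>2 * real n ^ i / (sqrt (real n) * fact (2 * n + i))) \<longlonglongrightarrow> sqrt pi / 2 ^ i"
proof (cases "i = 0")
  case True
  thus ?thesis using central_binomial_asymp by (simp add: mult.commute)
next
  case False
  with assms have i: "i = 1" by simp
  have "(\<lambda>n. real n / (2 * real n + 1)) \<longlonglongrightarrow> 1 / 2" by real_asymp
  from tendsto_mult[OF central_binomial_asymp this]
  have "(\<lambda>n. 4 ^ n * (fact n)\<^sup>2 / (fact (2 * n) * sqrt (real n)) * (real n / (2 * real n + 1))) \<longlonglongrightarrow> sqrt pi / 2" by simp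
  thus ?thesis by (simp add: i mult_ac add_ac)
qed

text \<open>The left side does not depend on \<open>n\<close>. Unrolled to order
  \<open>2 n + i\<close>, it is a product of three sequences with known limits: Euler's product, the
  moment ratio and the factorial ratio.\<close>

lemma pcfU_moment_value:
  assumes U: "is_pcfU a U" and i: "i \<le> 1"
  shows "(a + 1/2 + of_nat i) * pcfU_moment U i
    = rGamma (a / 2 + 1 / 4 + of_nat i / 2) * of_real (sqrt pi) / 2 ^ i * (2 * 2 powr (of_nat i / 2 - a / 2 - 3 / 4))"
proof -
  define q where "q = (a + 1/2 + of_nat i) / 2"
  define c :: complex where "c = 2 powr (of_nat i / 2 - a / 2 - 3 / 4)"
  define X where "X = (a + 1/2 + of_nat i) * pcfU_moment U i"
  have c: "c \<noteq> 0" by (simp add: c_def)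
  have fi: "fact i = (1 :: complex)" using i by (cases i) auto
  have "(\<lambda>n. pochhammer q (n + 1) / (fact n * of_nat n powr q) * (pcfU_moment U (2 * n + i) / moment_scale a i n)
     * (of_real (4 ^ n * (fact n)\<^sup>2 * real n ^ i / (sqrt (real n) * fact (2 * n + i))) * (2 * c)))
     \<longlonglongrightarrow> rGamma q * 1 * (of_real (sqrt pi / 2 ^ i) * (2 * c))"
    by (intro tendsto_intros pochhammer_asymp pcfU_moment_asymp[OF U] fact_double_asymp i)
  moreover have "\<forall>\<^sub>F n in sequentially. pochhammer q (n + 1) / (fact n * of_nat n powr q) * (pcfU_moment U (2 * n + i) / moment_scale a i n)
     * (of_real (4 ^ n * (fact n)\<^sup>2 * real n ^ i / (sqrt (real n) * fact (2 * n + i))) * (2 * c)) = X"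
    using eventually_gt_at_top[of 0]
  proof eventually_elim
    case (elim n)
    define P Q R S where "P = (of_nat n :: complex) powr q" and "Q = (of_nat n :: complex) powr (of_nat i / 2 + 1 / 4 - a / 2 - 1)"
      and "R = complex_of_real (real n ^ i)" and "S = complex_of_real (sqrt (real n))"
    have nz: "P \<noteq> 0" "Q \<noteq> 0" "S \<noteq> 0" using elim by (auto simp: P_def Q_def S_def)
    have "S = of_real (real n) powr of_real (1/2)"
      by (simp only: S_def powr_of_real powr_half_sqrt of_nat_0_le_iff)
    hence "S = of_nat n powr (1/2)" by simp
    moreover have "R = of_nat n powr (of_nat i)" using elim by (simp add: R_def)
    \<comment> \<open>All powers of \<open>n\<close> from the three sequences cancel.\<close>
    moreover have "q + (of_nat i / 2 + 1 / 4 - a / 2 - 1) + 1/2 = of_nat i" by (simp add: q_def field_simps)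
    ultimately have R: "R = P * Q * S"
      by (simp add: P_def Q_def flip: powr_add)
    have X: "X = 2 ^ (n + 1) * pochhammer q (n + 1) / fact (2 * n + i) * pcfU_moment U (2 * n + i)"
      using pcfU_moment_unroll[OF U, of i n] by (simp add: X_def q_def fi)
    have 4: "(4 :: complex) ^ n = 2 ^ n * 2 ^ n" by (simp flip: power_mult_distrib)
    have alg: "p / (F * P) * (m / (c * k * (F * Q))) * (k * k * F\<^sup>2 * (P * Q * S) / (S * H) * (2 * c)) = 2 * k * p / H * m"
      if "F \<noteq> 0" "k \<noteq> 0" for p F m k H :: complex
      using nz c that by (simp add: power2_eq_square)
    have h: "of_real (4 ^ n * (fact n)\<^sup>2 * real n ^ i / (sqrt (real n) * fact (2 * n + i))) = 2 ^ n * 2 ^ n * (fact n)\<^sup>2 * (P * Q * S) / (S * fact (2 * n + i))"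
      unfolding R[symmetric] 4[symmetric] by (simp add: R_def S_def)
    show ?case
      unfolding moment_scale_def X P_def[symmetric] Q_def[symmetric] c_def[symmetric] h
      by (subst alg) simp_all
  qed
  ultimately have "(\<lambda>n. X) \<longlonglongrightarrow> rGamma q * 1 * (of_real (sqrt pi / 2 ^ i) * (2 * c))"
    by (rule Lim_transform_eventually)
  hence "X = rGamma q * (of_real (sqrt pi / 2 ^ i) * (2 * c))" by (simp add: LIMSEQ_const_iff)
  moreover have "q = a / 2 + 1 / 4 + of_nat i / 2" by (simp add: q_def field_simps)
  ultimately show ?thesis by (simp add: X_def c_def)
qed

text \<open>Orders 1 and 0 of the recurrence give \<open>U 0\<close> and \<open>- deriv U 0\<close>.
  Since \<open>rGamma\<close> is entire, with zeros at the poles of Gamma, the formulas hold for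
  every complex \<open>a\<close>.\<close>

lemma pcfU_at_0:
  assumes U: "is_pcfU a U"
  shows "U 0 = of_real (sqrt pi) * rGamma (a / 2 + 3 / 4) / 2 powr (a / 2 + 1 / 4)"
    and "deriv U 0 = - of_real (sqrt pi) * rGamma (a / 2 + 1 / 4) / 2 powr (a / 2 - 1 / 4)"
proof -
  have "U 0 = (a + 1/2 + of_nat 1) * pcfU_moment U 1"
    using pcfU_moment_rec[OF U, of 1] by simp
  also have "\<dots> = rGamma (a / 2 + 1 / 4 + of_nat 1 / 2) * of_real (sqrt pi) / 2 ^ 1 * (2 * 2 powr (of_nat 1 / 2 - a / 2 - 3 / 4))"
    by (rule pcfU_moment_value[OF U]) simp
  also have "a / 2 + 1 / 4 + of_nat 1 / 2 = a / 2 + 3 / 4" by simp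
  also have "of_nat 1 / 2 - a / 2 - 3 / 4 = - (a / 2 + 1 / 4)" by simp
  finally show "U 0 = of_real (sqrt pi) * rGamma (a / 2 + 3 / 4) / 2 powr (a / 2 + 1 / 4)"
    by (simp only: powr_minus) (simp add: field_simps)
  have "- deriv U 0 = (a + 1/2 + of_nat 0) * pcfU_moment U 0"
    using pcfU_moment_rec[OF U, of 0] by simp
  also have "\<dots> = rGamma (a / 2 + 1 / 4 + of_nat 0 / 2) * of_real (sqrt pi) / 2 ^ 0 * (2 * 2 powr (of_nat 0 / 2 - a / 2 - 3 / 4))"
    by (rule pcfU_moment_value[OF U]) simp
  also have "of_nat 0 / 2 - a / 2 - 3 / 4 = - (a / 2 - 1 / 4) - 1" by simp
  also have "2 * 2 powr (- (a / 2 - 1 / 4) - 1) = inverse (2 powr (a / 2 - 1 / 4))"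
  proof -
    have "2 * 2 powr (- x - 1) = inverse (2 powr x)" for x :: complex by (simp add: powr_diff powr_minus)
    thus ?thesis .
  qed
  finally show "deriv U 0 = - of_real (sqrt pi) * rGamma (a / 2 + 1 / 4) / 2 powr (a / 2 - 1 / 4)"
    by (simp add: field_simps) (metis add.inverse_inverse)
qed

section \<open>Taylor coefficients\<close>

lemma higher_deriv_has_field_derivative:
  fixes f :: "complex \<Rightarrow> complex"
  assumes "f holomorphic_on UNIV"
  shows "((deriv ^^ k) f has_field_derivative (deriv ^^ Suc k) f z) (at z)"
  using holomorphic_derivI[OF holomorphic_higher_deriv[OF assms open_UNIV], of z k] by simp

text \<open>Leibniz' rule for the derivative of order \<open>k + 2\<close> of
  \<open>(z^2 / 4 + a) U\<close>; only three terms occur because the first factor is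
  quadratic.\<close>

lemma pcfU_higher_deriv:
  assumes "is_pcfU a U"
  shows "(deriv ^^ (k + 4)) U z = (z\<^sup>2 / 4 + a) * (deriv ^^ (k + 2)) U z
     + of_nat (k + 2) * z / 2 * (deriv ^^ (k + 1)) U z
     + of_nat (k + 2) * of_nat (k + 1) / 4 * (deriv ^^ k) U z"
proof -
  have hol: "U holomorphic_on UNIV" using assms by (simp add: is_pcfU_def)
  define D where "D = (\<lambda>k. (deriv ^^ k) U)"
  have D: "(D k has_field_derivative D (Suc k) z) (at z)" for k z
    unfolding D_def by (rule higher_deriv_has_field_derivative[OF hol])
  have D2: "D 2 = (\<lambda>z. (z\<^sup>2 / 4 + a) * D 0 z)"
    using assms by (simp add: is_pcfU_def D_def numeral_2_eq_2 fun_eq_iff)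
  have uniq: "D (Suc j) z = y" if "D j = F" "(F has_field_derivative y) (at z)" for j F y z
    using DERIV_unique[OF D[of j z]] that by simp
  have D3: "D 3 = (\<lambda>z. (z\<^sup>2 / 4 + a) * D 1 z + z / 2 * D 0 z)"
  proof
    fix z
    have "D (Suc 2) z = (z\<^sup>2 / 4 + a) * D 1 z + z / 2 * D 0 z"
      by (rule uniq[OF D2]) (auto intro!: derivative_eq_intros D[THEN DERIV_chain2] simp: algebra_simps)
    thus "D 3 z = (z\<^sup>2 / 4 + a) * D 1 z + z / 2 * D 0 z" by (simp add: numeral_3_eq_3)
  qed
  have "D (k + 4) z = (z\<^sup>2 / 4 + a) * D (k + 2) z + of_nat (k + 2) * z / 2 * D (k + 1) z
     + of_nat (k + 2) * of_nat (k + 1) / 4 * D k z" for k z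
  proof (induction k arbitrary: z)
    case 0
    have "D (Suc 3) z = (z\<^sup>2 / 4 + a) * D 2 z + z * D 1 z + 1 / 2 * D 0 z"
      by (rule uniq[OF D3])
         (auto intro!: derivative_eq_intros D[THEN DERIV_chain2] simp: field_simps numeral_2_eq_2)
    thus ?case by (simp add: numeral_eq_Suc)
  next
    case (Suc k)
    have *: "D (k + 4) = (\<lambda>z. (z\<^sup>2 / 4 + a) * D (k + 2) z + of_nat (k + 2) * z / 2 * D (k + 1) z
       + of_nat (k + 2) * of_nat (k + 1) / 4 * D k z)"
      using Suc.IH by blast
    have step: "D (Suc (k + 4)) z = (z / 2 * D (k + 2) z + (z\<^sup>2 / 4 + a) * D (Suc (k + 2)) z)
       + (of_nat (k + 2) / 2 * D (k + 1) z + of_nat (k + 2) * z / 2 * D (Suc (k + 1)) z)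
       + of_nat (k + 2) * of_nat (k + 1) / 4 * D (Suc k) z"
      by (rule uniq[OF *])
         (auto intro!: derivative_eq_intros D[THEN DERIV_chain2] simp: field_simps)
    have "Suc k + 4 = Suc (k + 4)" "Suc k + 2 = Suc (k + 2)" "Suc k + 1 = Suc (k + 1)" by simp_all
    thus ?case by (simp only: step) (simp add: field_simps)
  qed
  thus ?thesis by (simp add: D_def)
qed

text \<open>At 0 the middle term of the derivative recurrence vanishes, so even and odd orders
  decouple. The coefficients \<open>(2s+2)(2s+1)/4\<close> and \<open>(2s+3)(2s+2)/4\<close> are
  those in the recurrences of \<open>pc_alpha\<close> and \<open>pc_beta\<close>.\<close>

lemma pcfU_derivs_0:
  assumes U: "is_pcfU a U"
  shows "(deriv ^^ (2 * s)) U 0 = pc_alpha a s * U 0"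
    and "(deriv ^^ (2 * s + 1)) U 0 = pc_beta a s * deriv U 0"
proof -
  have hol: "U holomorphic_on UNIV" and ode: "\<And>z. deriv (deriv U) z = (z\<^sup>2 / 4 + a) * U z"
    using U by (auto simp: is_pcfU_def)
  have d3: "deriv (deriv (deriv U)) 0 = a * deriv U 0"
  proof -
    have "deriv (deriv U) = (\<lambda>z. (z\<^sup>2 / 4 + a) * U z)" using ode by blast
    moreover have "((\<lambda>z. (z\<^sup>2 / 4 + a) * U z) has_field_derivative a * deriv U 0) (at 0)"
      using higher_deriv_has_field_derivative[OF hol, of 0 0]
      by (auto intro!: derivative_eq_intros)
    ultimately show ?thesis by (simp add: DERIV_imp_deriv)
  qed
  show "(deriv ^^ (2 * s)) U 0 = pc_alpha a s * U 0"
  proof (induction s rule: induct_nat_012)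
    case (ge2 s)
    have "2 * Suc (Suc s) = 2 * s + 4" by simp
    hence rec: "(deriv ^^ (2 * Suc (Suc s))) U 0
      = a * (deriv ^^ (2 * Suc s)) U 0 + of_nat (2 * s + 2) * of_nat (2 * s + 1) / 4 * (deriv ^^ (2 * s)) U 0"
      using pcfU_higher_deriv[OF U, of "2 * s" 0] by (simp only: mult_Suc_right) simp
    show ?case unfolding rec ge2.IH by (simp add: field_simps)
  qed (use ode in \<open>simp_all add: numeral_2_eq_2\<close>)
  show "(deriv ^^ (2 * s + 1)) U 0 = pc_beta a s * deriv U 0"
  proof (induction s rule: induct_nat_012)
    case (ge2 s)
    have "2 * Suc (Suc s) + 1 = (2 * s + 1) + 4" by simp
    hence rec: "(deriv ^^ (2 * Suc (Suc s) + 1)) U 0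
      = a * (deriv ^^ (2 * Suc s + 1)) U 0 + of_nat (2 * s + 3) * of_nat (2 * s + 2) / 4 * (deriv ^^ (2 * s + 1)) U 0"
      using pcfU_higher_deriv[OF U, of "2 * s + 1" 0] by (simp only: mult_Suc_right) simp
    show ?case unfolding rec ge2.IH by (simp add: field_simps)
  qed (use d3 in \<open>simp_all add: numeral_2_eq_2\<close>)
qed

text \<open>Inside the unit disc this is Taylor's remainder. Outside it, the bounded
  \<open>U\<close> and each monomial of degree below \<open>n\<close> are at most a constant times
  \<open>norm z ^ n\<close>.\<close>

lemma Taylor_bound_on_wedge:
  assumes hol: "U holomorphic_on UNIV" and bd: "\<And>z. z \<in> wedge m \<Longrightarrow> norm (U z) \<le> B"
  shows "\<exists>C. \<forall>z\<in>wedge m. norm (U z - (\<Sum>k<n. (deriv ^^ k) U 0 / fact k * z ^ k)) \<le> C * norm z ^ n"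
proof (cases n)
  case 0
  thus ?thesis using bd by auto
next
  case (Suc p)
  have "continuous_on UNIV ((deriv ^^ n) U)"
    using hol by (intro holomorphic_on_imp_continuous_on holomorphic_higher_deriv) auto
  hence "compact ((deriv ^^ n) U ` cball 0 1)"
    by (intro compact_continuous_image) (auto intro: continuous_on_subset)
  then obtain B1 where B1: "\<And>z. norm z \<le> 1 \<Longrightarrow> norm ((deriv ^^ n) U z) \<le> B1"
    using compact_imp_bounded by (fastforce simp: bounded_iff)
  define S where "S = (\<Sum>k<n. norm ((deriv ^^ k) U 0 / fact k))"
  define C where "C = max B1 (B + S)"
  have "norm (U z - (\<Sum>k<n. (deriv ^^ k) U 0 / fact k * z ^ k)) \<le> C * norm z ^ n" if z: "z \<in> wedge m" for z
  proof (cases "norm z \<le> 1")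
    case True
    have "norm ((deriv ^^ 0) U z - (\<Sum>i\<le>p. (deriv ^^ i) U 0 * (z - 0) ^ i / fact i)) \<le> B1 * norm (z - 0) ^ Suc p / fact p"
      by (rule complex_Taylor[of "cball 0 1"])
         (use True B1 Suc in \<open>auto intro: has_field_derivative_at_within higher_deriv_has_field_derivative[OF hol] simp del: funpow.simps\<close>)
    also have "\<dots> \<le> B1 * norm (z - 0) ^ Suc p / 1"
    proof (rule divide_left_mono)
      have "0 \<le> B1" by (rule order_trans[OF norm_ge_zero B1[of 0]]) simp
      thus "0 \<le> B1 * norm (z - 0) ^ Suc p" by simp
    qed (auto simp: fact_ge_1)
    also have "\<dots> \<le> C * norm z ^ n" using Suc by (auto simp: C_def intro!: mult_right_mono)
    finally show ?thesis using Suc by (simp add: lessThan_Suc_atMost)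
  next
    case False
    have B: "B \<ge> 0" by (rule order_trans[OF norm_ge_zero bd[OF z]])
    have "norm (U z - (\<Sum>k<n. (deriv ^^ k) U 0 / fact k * z ^ k)) \<le> norm (U z) + norm (\<Sum>k<n. (deriv ^^ k) U 0 / fact k * z ^ k)"
      by (rule norm_triangle_ineq4)
    also have "norm (U z) \<le> B * norm z ^ n"
      using bd[OF z] B False mult_left_mono[of 1 "norm z ^ n" B] by (simp add: one_le_power)
    also have "norm (\<Sum>k<n. (deriv ^^ k) U 0 / fact k * z ^ k) \<le> (\<Sum>k<n. norm ((deriv ^^ k) U 0 / fact k) * norm z ^ n)"
      using False
      by (intro sum_norm_le, unfold norm_mult[of _ "_ ^ _"] norm_power) (auto intro!: mult_left_mono power_increasing)
    also have "B * norm z ^ n + \<dots> = (B + S) * norm z ^ n"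
      by (simp only: S_def sum_distrib_right distrib_right)
    also have "\<dots> \<le> C * norm z ^ n" by (intro mult_right_mono) (auto simp: C_def)
    finally show ?thesis by simp
  qed
  thus ?thesis by blast
qed

section \<open>Rotation of the path and Watson's lemma\<close>

lemma exp_linear_gaussian_le:
  fixes c x r :: real
  assumes "c > 0"
  shows "exp (x * r - c * r\<^sup>2) \<le> exp ((x + 1)\<^sup>2 / (4 * c)) * exp (- r)"
proof -
  have "0 \<le> (2 * c * r - (x + 1))\<^sup>2 / (4 * c)" using assms by simp
  also have "\<dots> = (x + 1)\<^sup>2 / (4 * c) - (x + 1) * r + c * r\<^sup>2"
    using assms by (simp add: power2_eq_square field_simps)
  finally show ?thesis by (simp add: algebra_simps flip: exp_add)
qed

lemma norm_exp_mult_le: "norm (exp (- l * z)) \<le> exp (norm l * norm (z :: complex))"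
proof -
  have "Re (- l * z) \<le> norm (- l * z)" by (rule complex_Re_le_cmod)
  thus ?thesis by (simp add: norm_mult)
qed

text \<open>The Gaussian decay of \<open>U\<close> beats the exponential factor for every complex
  \<open>l\<close>, whatever the sign of \<open>Re (l * \<omega>)\<close>.\<close>

lemma absolutely_integrable_on_ray:
  assumes hol: "U holomorphic_on UNIV" and c: "c > 0" "B \<ge> 0"
    and bd: "\<And>z. z \<in> wedge m \<Longrightarrow> norm (U z) \<le> B * exp (- c * (norm z)\<^sup>2)"
    and \<omega>: "\<omega> \<in> wedge m" "norm \<omega> = 1"
  shows "(\<lambda>r. exp (- l * (\<omega> * of_real r)) * U (\<omega> * of_real r)) absolutely_integrable_on {0..}"
proof (rule absolutely_integrable_exp_bound)
  have "continuous_on UNIV U" using hol by (rule holomorphic_on_imp_continuous_on)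
  hence "continuous_on {0..} (\<lambda>r::real. U (\<omega> * of_real r))"
    by (rule continuous_on_compose2) (auto intro!: continuous_intros)
  thus "continuous_on {0..} (\<lambda>r::real. exp (- l * (\<omega> * of_real r)) * U (\<omega> * of_real r))"
    by (intro continuous_intros)
next
  fix r :: real assume r: "r \<ge> 0"
  have "norm (exp (- l * (\<omega> * of_real r)) * U (\<omega> * of_real r))
     \<le> exp (norm l * norm (\<omega> * of_real r)) * (B * exp (- c * (norm (\<omega> * of_real r))\<^sup>2))"
    unfolding norm_mult[of "exp _"] by (intro mult_mono norm_exp_mult_le bd wedge_scale \<omega> r) auto
  also have "\<dots> = B * exp (norm l * r - c * r\<^sup>2)"
    using r \<omega> by (simp add: norm_mult algebra_simps flip: exp_add)
  also have "\<dots> \<le> B * (exp ((norm l + 1)\<^sup>2 / (4 * c)) * exp (- r))"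
    using c by (intro mult_left_mono exp_linear_gaussian_le)
  finally show "norm (exp (- l * (\<omega> * of_real r)) * U (\<omega> * of_real r))
     \<le> B * exp ((norm l + 1)\<^sup>2 / (4 * c)) * exp (- 1 * r)" by simp
qed simp

text \<open>The primitive of the entire integrand has the same limit along both rays, because the
  integrand is small on the chord joining them.\<close>

lemma pc_laplace_rotate:
  assumes hol: "U holomorphic_on UNIV" and c: "c > 0" "B \<ge> 0" and m: "m \<ge> 0"
    and bd: "\<And>z. z \<in> wedge m \<Longrightarrow> norm (U z) \<le> B * exp (- c * (norm z)\<^sup>2)"
    and \<omega>: "\<omega> \<in> wedge m" "norm \<omega> = 1"
  shows "pc_laplace U l = \<omega> * integral {0..} (\<lambda>r. exp (- l * (\<omega> * of_real r)) * U (\<omega> * of_real r))"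
proof -
  define f where "f = (\<lambda>z. exp (- l * z) * U z)"
  have "f holomorphic_on UNIV" unfolding f_def using hol by (intro holomorphic_intros)
  then obtain P where P: "\<And>z. (P has_field_derivative f z) (at z)"
    using holomorphic_convex_primitive'[of UNIV f] by auto
  have one: "1 \<in> wedge m" using m by (simp add: wedge_def)
  have ray: "((\<lambda>r. P (w * of_real r)) \<longlongrightarrow> P 0 + w * integral {0..} (\<lambda>r. f (w * of_real r))) at_top"
    if w: "w \<in> wedge m" "norm w = 1" for w
  proof -
    have ai: "(\<lambda>r. f (w * of_real r)) absolutely_integrable_on {0..}"
      unfolding f_def by (rule absolutely_integrable_on_ray[OF hol c bd w])
    have "((\<lambda>r. P (w * of_real r)) \<longlongrightarrow> P (w * of_real 0) + integral {0..} (\<lambda>r. w * f (w * of_real r))) at_top"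
    proof (rule FTC_tendsto_at_top)
      show "((\<lambda>r. P (w * of_real r)) has_vector_derivative w * f (w * of_real r)) (at r)" for r :: real
        using DERIV_chain2[OF P DERIV_cmult_Id[of w], of "of_real r" UNIV]
        by (intro has_vector_derivative_real_field) (simp add: mult.commute)
    qed (intro set_integrable_mult_right ai)
    thus ?thesis by simp
  qed
  have r0: "Re \<omega> > 0" using wedge_Re_pos[OF \<omega>(1)] \<omega>(2) by fastforce
  \<comment> \<open>Points of the chord have real part at least \<open>r * Re \<omega>\<close>, so
    the Gaussian rate \<open>c\<close> in \<open>norm z\<close> becomes the rate \<open>b\<close> in
    \<open>r\<close>.\<close>
  define b where "b = c * (Re \<omega>)\<^sup>2"
  have b: "b > 0" using c r0 by (simp add: b_def)
  have chord: "norm (P (of_real r) - P (\<omega> * of_real r)) \<le> (B * exp (norm l * r - b * r\<^sup>2)) * (2 * r)" if r: "r \<ge> 0" for r :: real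
  proof -
    let ?S = "closed_segment (of_real r) (\<omega> * of_real r)"
    have "norm (P (of_real r) - P (\<omega> * of_real r)) \<le> (B * exp (norm l * r - b * r\<^sup>2)) * norm (of_real r - \<omega> * of_real r)"
    proof (rule field_differentiable_bound[of ?S])
      fix z assume z: "z \<in> ?S"
      have zc: "z \<in> wedge m"
      proof -
        have "?S \<subseteq> wedge m"
          using wedge_scale[OF one r] wedge_scale[OF \<omega>(1) r] by (intro closed_segment_subset convex_wedge) simp_all
        thus ?thesis using z by blast
      qed
      obtain u where u: "0 \<le> u" "u \<le> 1" "z = (1 - u) *\<^sub>R of_real r + u *\<^sub>R (\<omega> * of_real r)"
        using z by (auto simp: closed_segment_def)
      have "norm z \<le> (1 - u) * r + u * r"
        unfolding u(3) using u(1,2) r \<omega>(2) by (intro norm_triangle_le) (simp add: norm_mult)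
      hence z1: "norm z \<le> r" by (simp add: algebra_simps)
      have "Re \<omega> \<le> 1" using complex_Re_le_cmod[of \<omega>] \<omega>(2) by simp
      hence "(1 - u) * (r * Re \<omega>) \<le> (1 - u) * r"
        using u(2) r by (intro mult_left_mono) (auto intro: mult_left_le)
      hence "r * Re \<omega> \<le> Re z" unfolding u(3) by (simp add: algebra_simps)
      hence z2: "r * Re \<omega> \<le> norm z" using complex_Re_le_cmod order_trans by blast
      show "norm (f z) \<le> B * exp (norm l * r - b * r\<^sup>2)"
      proof -
        have "norm (f z) \<le> exp (norm l * norm z) * (B * exp (- c * (norm z)\<^sup>2))"
          unfolding f_def norm_mult by (intro mult_mono norm_exp_mult_le bd zc) auto
        also have "\<dots> = B * exp (norm l * norm z - c * (norm z)\<^sup>2)"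
          by (simp add: algebra_simps flip: exp_add)
        also have "\<dots> \<le> B * exp (norm l * r - b * r\<^sup>2)"
        proof -
          have "norm l * norm z \<le> norm l * r" using z1 by (intro mult_left_mono) auto
          moreover have "c * (r * Re \<omega>)\<^sup>2 \<le> c * (norm z)\<^sup>2"
            using z2 r r0 c by (intro mult_left_mono power_mono) auto
          moreover have "c * (r * Re \<omega>)\<^sup>2 = b * r\<^sup>2" by (simp add: b_def power_mult_distrib)
          ultimately have "norm l * norm z - c * (norm z)\<^sup>2 \<le> norm l * r - b * r\<^sup>2" by linarith
          thus ?thesis using c by (simp add: mult_left_mono)
        qed
        finally show ?thesis .
      qed
      show "(P has_field_derivative f z) (at z within ?S)" by (rule has_field_derivative_at_within[OF P])
    qed auto
    also have "norm (of_real r - \<omega> * of_real r) \<le> 2 * r"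
      using norm_triangle_ineq4[of "of_real r" "\<omega> * of_real r"] r \<omega>(2) by (simp add: norm_mult)
    finally show ?thesis using c(2) by (simp add: mult_left_mono)
  qed
  have "((\<lambda>r. P (of_real r) - P (\<omega> * of_real r)) \<longlongrightarrow> 0) at_top"
  proof (rule Lim_null_comparison)
    show "\<forall>\<^sub>F r in at_top. norm (P (of_real r) - P (\<omega> * of_real r)) \<le> (B * exp (norm l * r - b * r\<^sup>2)) * (2 * r)"
      using eventually_ge_at_top[of 0] by eventually_elim (rule chord)
    define L where "L = norm l"
    have "((\<lambda>r. exp (L * r - b * r\<^sup>2) * (2 * r)) \<longlongrightarrow> 0) at_top" using b by real_asymp
    from tendsto_mult_right_zero[OF this, of B]
    show "((\<lambda>r. (B * exp (norm l * r - b * r\<^sup>2)) * (2 * r)) \<longlongrightarrow> 0) at_top" by (simp add: L_def mult_ac)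
  qed
  from tendsto_diff[OF ray[OF one] ray[OF \<omega>]]
  have "((\<lambda>r. P (of_real r) - P (\<omega> * of_real r)) \<longlongrightarrow>
     integral {0..} (\<lambda>r. f (of_real r)) - \<omega> * integral {0..} (\<lambda>r. f (\<omega> * of_real r))) at_top" by simp
  from tendsto_unique[OF _ this \<open>((\<lambda>r. P (of_real r) - P (\<omega> * of_real r)) \<longlongrightarrow> 0) at_top\<close>]
  show ?thesis by (simp add: pc_laplace_def f_def)
qed

text \<open>Watson's lemma with an explicit constant. On the rotated ray every Taylor term
  integrates exactly, and the remainder is dominated by a real integral of the same type.\<close>

lemma pc_laplace_remainder_bound:
  assumes hol: "U holomorphic_on UNIV" and c: "c > 0" "B \<ge> 0" and m: "m \<ge> 0"
    and bd: "\<And>z. z \<in> wedge m \<Longrightarrow> norm (U z) \<le> B * exp (- c * (norm z)\<^sup>2)"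
    and Taylor: "\<And>z. z \<in> wedge m \<Longrightarrow> norm (U z - (\<Sum>k<n. u k / fact k * z ^ k)) \<le> C * norm z ^ n"
    and \<omega>: "\<omega> \<in> wedge m" "norm \<omega> = 1" and pos: "Re (l * \<omega>) > 0"
  shows "norm (pc_laplace U l - (\<Sum>k<n. u k / l ^ Suc k)) \<le> C * fact n / Re (l * \<omega>) ^ Suc n"
proof -
  define \<mu> where "\<mu> = l * \<omega>"
  \<comment> \<open>The real rate, viewed as a complex number so that
    \<open>integral_power_exp\<close> also evaluates the majorant.\<close>
  define \<rho> where "\<rho> = complex_of_real (Re \<mu>)"
  define T where "T = (\<lambda>r::real. exp (- \<mu> * of_real r) * (\<Sum>k<n. u k / fact k * (\<omega> * of_real r) ^ k))"
  define E where "E = (\<lambda>r::real. exp (- \<mu> * of_real r) * U (\<omega> * of_real r))"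
  have \<mu>: "Re \<mu> > 0" using pos by (simp add: \<mu>_def)
  hence nz: "\<omega> \<noteq> 0" "l \<noteq> 0" by (auto simp: \<mu>_def)
  have E: "E absolutely_integrable_on {0..}"
    using absolutely_integrable_on_ray[OF hol c bd \<omega>, of l] by (simp add: E_def \<mu>_def mult.assoc)
  have T_eq: "T = (\<lambda>r. \<Sum>k<n. (u k / fact k * \<omega> ^ k) * (exp (- \<mu> * of_real r) * of_real r ^ k))"
    by (simp add: T_def sum_distrib_left power_mult_distrib mult_ac)
  have T: "(T has_integral (\<Sum>k<n. (u k / fact k * \<omega> ^ k) * (fact k / \<mu> ^ Suc k))) {0..}"
    unfolding T_eq
    using absolutely_integrable_power_exp[OF \<mu>] integral_power_exp[OF \<mu>]
    by (intro has_integral_sum has_integral_mult_right)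
       (auto simp: has_integral_iff dest: set_lebesgue_integral_eq_integral(1))
  \<comment> \<open>All powers of \<open>\<omega>\<close> cancel except one, which the factor in
    front of the rotated integral removes.\<close>
  have "(\<Sum>k<n. (u k / fact k * \<omega> ^ k) * (fact k / \<mu> ^ Suc k)) = (\<Sum>k<n. u k / l ^ Suc k) / \<omega>"
    using nz by (simp add: \<mu>_def power_mult_distrib sum_divide_distrib field_simps)
  hence "\<omega> * integral {0..} T = (\<Sum>k<n. u k / l ^ Suc k)"
    using integral_unique[OF T] nz by simp
  moreover have "pc_laplace U l = \<omega> * integral {0..} E"
    using pc_laplace_rotate[OF hol c m bd \<omega>, of l] by (simp add: E_def \<mu>_def mult.assoc)
  ultimately have "pc_laplace U l - (\<Sum>k<n. u k / l ^ Suc k) = \<omega> * (integral {0..} E - integral {0..} T)"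
    by (simp add: algebra_simps)
  also have "integral {0..} E - integral {0..} T = integral {0..} (\<lambda>r. E r - T r)"
    using E T by (intro integral_diff[symmetric]) (auto simp: has_integral_iff dest: set_lebesgue_integral_eq_integral(1))
  finally have "norm (pc_laplace U l - (\<Sum>k<n. u k / l ^ Suc k)) = norm (integral {0..} (\<lambda>r. E r - T r))"
    using \<omega>(2) by (simp add: norm_mult)
  also have "\<dots> \<le> integral {0..} (\<lambda>r. C * Re (exp (- \<rho> * of_real r) * of_real r ^ n))"
  proof (rule integral_norm_bound_integral)
    show "(\<lambda>r. E r - T r) integrable_on {0..}"
      using E T by (intro integrable_diff) (auto simp: has_integral_iff dest: set_lebesgue_integral_eq_integral(1))
    show "(\<lambda>r. C * Re (exp (- \<rho> * of_real r) * of_real r ^ n)) integrable_on {0..}"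
      using integrable_linear[OF set_lebesgue_integral_eq_integral(1)[OF absolutely_integrable_power_exp[of \<rho> n]] bounded_linear_Re] \<mu>
      by (intro integrable_on_mult_right) (simp add: o_def \<rho>_def)
    fix r :: real assume "r \<in> {0..}"
    hence r: "r \<ge> 0" by simp
    have "norm (E r - T r) = exp (- Re \<mu> * r) * norm (U (\<omega> * of_real r) - (\<Sum>k<n. u k / fact k * (\<omega> * of_real r) ^ k))"
      by (simp add: E_def T_def norm_mult flip: right_diff_distrib)
    also have "\<dots> \<le> exp (- Re \<mu> * r) * (C * norm (\<omega> * of_real r) ^ n)"
      by (intro mult_left_mono Taylor wedge_scale \<omega> r) simp
    also have "\<dots> = C * (exp (- Re \<mu> * r) * r ^ n)" using r \<omega>(2) by (simp add: norm_mult)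
    also have "exp (- \<rho> * of_real r) * of_real r ^ n = of_real (exp (- Re \<mu> * r) * r ^ n)"
      by (simp add: \<rho>_def of_real_exp)
    hence "exp (- Re \<mu> * r) * r ^ n = Re (exp (- \<rho> * of_real r) * of_real r ^ n)"
      by (simp only: Re_complex_of_real)
    finally show "norm (E r - T r) \<le> C * Re (exp (- \<rho> * of_real r) * of_real r ^ n)" .
  qed
  also have "\<dots> = C * Re (fact n / \<rho> ^ Suc n)"
    using integral_linear[OF set_lebesgue_integral_eq_integral(1)[OF absolutely_integrable_power_exp[of \<rho> n]] bounded_linear_Re] \<mu>
    using integral_power_exp[of \<rho> n] by (simp add: o_def \<rho>_def)
  also have "fact n / \<rho> ^ Suc n = of_real (fact n / Re \<mu> ^ Suc n)" by (simp add: \<rho>_def)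
  finally show ?thesis by (simp add: \<mu>_def)
qed

text \<open>Turning by \<open>pi/4 - \<delta>/2\<close> against the sign of \<open>Arg l\<close>
  leaves an argument of at most \<open>pi/2 - \<delta>/2\<close> in modulus, whose cosine is at
  least \<open>sin (\<delta>/2)\<close>. The turning angle stays below \<open>pi/4\<close>, where
  \<open>U\<close> decays.\<close>

lemma rotate_sector_into_half_plane:
  assumes \<delta>: "0 < \<delta>" "\<delta> \<le> pi / 8" and l: "l \<in> pc_sector \<delta>"
  shows "\<exists>\<omega>\<in>wedge (tan (pi / 4 - \<delta> / 2)). norm \<omega> = 1 \<and> Re (l * \<omega>) \<ge> sin (\<delta> / 2) * norm l"
proof -
  define \<phi> where "\<phi> = pi / 4 - \<delta> / 2"
  define \<theta> where "\<theta> = (if Arg l \<ge> 0 then - \<phi> else \<phi>)"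
  have \<phi>: "0 < \<phi>" "\<phi> < pi / 4" using \<delta> by (auto simp: \<phi>_def)
  have l: "l \<noteq> 0" "\<bar>Arg l\<bar> \<le> 3 * pi / 4 - \<delta>" using l by (auto simp: pc_sector_def)
  have cos: "cos \<phi> > 0" using \<phi> by (intro cos_gt_zero) auto
  have "sin \<phi> \<ge> 0" using \<phi> by (intro sin_ge_zero) auto
  hence "cis \<theta> \<in> wedge (tan \<phi>)"
    using cos by (auto simp: wedge_def \<theta>_def tan_def)
  moreover have "Re (l * cis \<theta>) \<ge> sin (\<delta> / 2) * norm l"
  proof -
    have "\<bar>Arg l + \<theta>\<bar> \<le> pi / 2 - \<delta> / 2"
      using l(2) \<delta> by (auto simp: \<theta>_def \<phi>_def abs_if split: if_splits)
    hence "cos (pi / 2 - \<delta> / 2) \<le> cos \<bar>Arg l + \<theta>\<bar>"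
      using \<delta> by (intro cos_monotone_0_pi_le) auto
    moreover have "cos (pi / 2 - \<delta> / 2) = sin (\<delta> / 2)" by (simp add: cos_sin_eq)
    ultimately have "sin (\<delta> / 2) \<le> cos (Arg l + \<theta>)" by simp
    moreover have "l * cis \<theta> = of_real (norm l) * cis (Arg l + \<theta>)"
      using rcis_cmod_Arg[of l] by (simp add: rcis_def flip: cis_mult)
    ultimately show ?thesis by (simp add: mult.commute mult_left_mono)
  qed
  ultimately show ?thesis unfolding \<phi>_def by (intro bexI[of _ "cis \<theta>"]) auto
qed

section \<open>Uniform expansion in the sector\<close>

lemma pc_sector_antimono: "\<delta>' \<le> \<delta> \<Longrightarrow> pc_sector \<delta> \<subseteq> pc_sector \<delta>'"
  by (auto simp: pc_sector_def)

lemma sum_split_parity: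
  fixes u :: "nat \<Rightarrow> complex"
  shows "(\<Sum>k<2 * N. u k / l ^ Suc k) = (\<Sum>s<N. u (2 * s) / l ^ (2 * s)) / l + (\<Sum>s<N. u (2 * s + 1) / l ^ (2 * s)) / l\<^sup>2"
proof (induction N)
  case (Suc N)
  have "{..<2 * Suc N} = insert (2 * N + 1) (insert (2 * N) {..<2 * N})" by auto
  thus ?case using Suc by (simp add: add_divide_distrib power2_eq_square mult_ac)
qed simp

text \<open>One wedge, depending only on \<open>\<delta>\<close>, contains the rays for all
  \<open>l\<close> in the sector, and \<open>Re (l * \<omega>)\<close> is at least a fixed multiple
  of \<open>norm l\<close>. This makes the constant uniform.\<close>

lemma pc_laplace_expansion:
  assumes U: "is_pcfU a U" and "\<delta> > 0"
  shows "\<exists>C. \<forall>l\<in>pc_sector \<delta>.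
     norm (pc_laplace U l - (\<Sum>k<n. (deriv ^^ k) U 0 / l ^ Suc k)) \<le> C / norm l ^ Suc n"
proof -
  \<comment> \<open>Shrinking \<open>\<delta>\<close> only enlarges the sector, so the angle may be
    assumed small.\<close>
  define \<delta>' where "\<delta>' = min \<delta> (pi / 8)"
  have \<delta>': "0 < \<delta>'" "\<delta>' \<le> pi / 8" "\<delta>' \<le> \<delta>" using assms by (auto simp: \<delta>'_def)
  define m where "m = tan (pi / 4 - \<delta>' / 2)"
  have hol: "U holomorphic_on UNIV" using U by (simp add: is_pcfU_def)
  have m: "0 \<le> m" "m < 1"
  proof -
    show "0 \<le> m" unfolding m_def using \<delta>' by (intro less_imp_le tan_gt_zero) auto
    have "m < tan (pi / 4)" unfolding m_def using \<delta>' by (intro tan_monotone) auto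
    thus "m < 1" by (simp add: tan_45)
  qed
  obtain B c where B: "B \<ge> 0" "c > 0" "\<And>z. z \<in> wedge m \<Longrightarrow> norm (U z) \<le> B * exp (- c * (norm z)\<^sup>2)"
    using pcfU_wedge_bound[OF U m] by auto
  have "norm (U z) \<le> B" if "z \<in> wedge m" for z
  proof -
    have "B * exp (- c * (norm z)\<^sup>2) \<le> B * 1" using B by (intro mult_left_mono) auto
    with B(3)[OF that] show ?thesis by linarith
  qed
  then obtain C0 where C0: "\<And>z. z \<in> wedge m \<Longrightarrow> norm (U z - (\<Sum>k<n. (deriv ^^ k) U 0 / fact k * z ^ k)) \<le> C0 * norm z ^ n"
    using Taylor_bound_on_wedge[OF hol, of m B n] by blast
  \<comment> \<open>A nonnegative constant, so that the lower bound for
    \<open>Re (l * \<omega>)\<close> can be inserted in the denominator.\<close>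
  define C where "C = max C0 0"
  have C: "norm (U z - (\<Sum>k<n. (deriv ^^ k) U 0 / fact k * z ^ k)) \<le> C * norm z ^ n" if "z \<in> wedge m" for z
  proof -
    have "C0 * norm z ^ n \<le> C * norm z ^ n" by (intro mult_right_mono) (auto simp: C_def)
    with C0[OF that] show ?thesis by linarith
  qed
  have s: "sin (\<delta>' / 2) > 0" using \<delta>' by (intro sin_gt_zero) auto
  show ?thesis
  proof (intro exI[of _ "C * fact n / sin (\<delta>' / 2) ^ Suc n"] ballI)
    fix l assume "l \<in> pc_sector \<delta>"
    hence l: "l \<in> pc_sector \<delta>'" using pc_sector_antimono[OF \<delta>'(3)] by blast
    hence l0: "norm l > 0" by (simp add: pc_sector_def)
    obtain \<omega> where \<omega>: "\<omega> \<in> wedge m" "norm \<omega> = 1" "Re (l * \<omega>) \<ge> sin (\<delta>' / 2) * norm l"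
      using rotate_sector_into_half_plane[OF \<delta>'(1,2) l] unfolding m_def by blast
    have pos: "sin (\<delta>' / 2) * norm l > 0" using s l0 by simp
    hence "Re (l * \<omega>) > 0" using \<omega>(3) by linarith
    hence "norm (pc_laplace U l - (\<Sum>k<n. (deriv ^^ k) U 0 / l ^ Suc k)) \<le> C * fact n / Re (l * \<omega>) ^ Suc n"
      by (intro pc_laplace_remainder_bound[OF hol B(2,1) m(1) B(3) C \<omega>(1,2)])
    also have "\<dots> \<le> C * fact n / (sin (\<delta>' / 2) * norm l) ^ Suc n"
    proof (rule divide_left_mono)
      show "(sin (\<delta>' / 2) * norm l) ^ Suc n \<le> Re (l * \<omega>) ^ Suc n"
        using pos \<omega>(3) by (intro power_mono) auto
      show "0 \<le> C * fact n" by (simp add: C_def)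
      show "0 < Re (l * \<omega>) ^ Suc n * (sin (\<delta>' / 2) * norm l) ^ Suc n"
        by (intro mult_pos_pos zero_less_power pos less_le_trans[OF pos \<omega>(3)])
    qed
    also have "\<dots> = C * fact n / sin (\<delta>' / 2) ^ Suc n / norm l ^ Suc n"
      by (simp only: power_mult_distrib divide_divide_eq_left)
    finally show "norm (pc_laplace U l - (\<Sum>k<n. (deriv ^^ k) U 0 / l ^ Suc k)) \<le> C * fact n / sin (\<delta>' / 2) ^ Suc n / norm l ^ Suc n" .
  qed
qed

lemma pcfU_laplace_partial_sum:
  assumes U: "is_pcfU a U"
  shows "(\<Sum>k<2 * N. (deriv ^^ k) U 0 / l ^ Suc k)
    = (U 0 / l) * (\<Sum>s<N. pc_alpha a s / l ^ (2 * s)) + (deriv U 0 / l\<^sup>2) * (\<Sum>s<N. pc_beta a s / l ^ (2 * s))"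
  unfolding sum_split_parity pcfU_derivs_0[OF U] by (simp add: sum_distrib_right sum_distrib_left sum_divide_distrib mult_ac)

theorem theorem5p1:
  fixes a :: complex and U :: "complex \<Rightarrow> complex"
  assumes "is_pcfU a U"
  shows "U 0 = of_real (sqrt pi) * rGamma (a / 2 + 3 / 4) / 2 powr (a / 2 + 1 / 4) \<and>
         deriv U 0 = - of_real (sqrt pi) * rGamma (a / 2 + 1 / 4) / 2 powr (a / 2 - 1 / 4) \<and>
         (\<forall>\<delta>>0. \<forall>N::nat. \<exists>C R. \<forall>l\<in>pc_sector \<delta>. norm l \<ge> R \<longrightarrow>
           norm (pc_laplace U l
                 - (U 0 / l) * (\<Sum>s<N. pc_alpha a s / l ^ (2 * s))
                 - (deriv U 0 / l\<^sup>2) * (\<Sum>s<N. pc_beta a s / l ^ (2 * s)))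
             \<le> C / norm l ^ (2 * N + 1))"
proof (intro conjI allI impI)
  show "U 0 = of_real (sqrt pi) * rGamma (a / 2 + 3 / 4) / 2 powr (a / 2 + 1 / 4)"
    and "deriv U 0 = - of_real (sqrt pi) * rGamma (a / 2 + 1 / 4) / 2 powr (a / 2 - 1 / 4)"
    by (rule pcfU_at_0[OF assms])+
next
  fix \<delta> :: real and N :: nat
  assume "\<delta> > 0"
  then obtain C where "\<forall>l\<in>pc_sector \<delta>.
      norm (pc_laplace U l - (\<Sum>k<2 * N. (deriv ^^ k) U 0 / l ^ Suc k)) \<le> C / norm l ^ Suc (2 * N)"
    using pc_laplace_expansion[OF assms] by blast
  \<comment> \<open>\<open>N\<close> terms of each series are the Taylor terms of order below
    \<open>2 N\<close>. The bound holds in the whole sector, so any \<open>R\<close> will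
    do.\<close>
  thus "\<exists>C R. \<forall>l\<in>pc_sector \<delta>. norm l \<ge> R \<longrightarrow>
      norm (pc_laplace U l
            - (U 0 / l) * (\<Sum>s<N. pc_alpha a s / l ^ (2 * s))
            - (deriv U 0 / l\<^sup>2) * (\<Sum>s<N. pc_beta a s / l ^ (2 * s)))
        \<le> C / norm l ^ (2 * N + 1)"
    unfolding pcfU_laplace_partial_sum[OF assms] diff_diff_eq[symmetric] unfolding Suc_eq_plus1 by blast
qed

end
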